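(* Let $n\ge2$, let $\Omega\in L^s(\mathbf{S}^{n-1})$ with $1<s\leq\infty$, where $\Omega$ is homogeneous of degree zero on $\mathbb R^n$. Let $0<\alpha<n$, $1\leq p<q<\infty$, $0<\kappa<1-\frac{\alpha p}{n}$ and $\frac1q=\frac1p-\frac{\alpha}{n(1-\kappa)}$. (i) If $s'=p<n/\alpha$, then there is a constant $C>0$ independent of $f$ such that $\|T_{\Omega,\alpha}(f)\|_{WL^{q,\kappa}}\le C\|f\|_{L^{p,\kappa}}$ for all $f\in L^{p,\kappa}(\mathbb R^n)$. (ii) If $s'<p<n/\alpha$, then there is a constant $C>0$ independent of $f$ such that $\|T_{\Omega,\alpha}(f)\|_{L^{q,\kappa}}\le C\|f\|_{L^{p,\kappa}}$ for all $f\in L^{p,\kappa}(\mathbb R^n)$.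
   Context: $\mathbf{S}^{n-1}$ is the unit sphere of $\mathbb R^n$ with normalized Lebesgue measure; $m$ is Lebesgue measure; $1/s+1/s'=1$ ($s'=1$ if $s=\infty$). $T_{\Omega,\alpha}f(x):=\int_{\mathbb R^n}\frac{\Omega(x-y)}{|x-y|^{n-\alpha}}f(y)\,dy$. Morrey space $L^{p,\kappa}(\mathbb R^n)$: $\|f\|_{L^{p,\kappa}}:=\sup_{B}\big(\frac{1}{m(B)^{\kappa}}\int_B|f(x)|^p\,dx\big)^{1/p}<\infty$. Weak Morrey space $WL^{p,\kappa}(\mathbb R^n)$: $\|f\|_{WL^{p,\kappa}}:=\sup_{B}\frac{1}{m(B)^{\kappa/p}}\sup_{\lambda>0}\lambda\, m(\{x\in B:|f(x)|>\lambda\})^{1/p}<\infty$. Suprema are over all balls $B\subset\mathbb R^n$. *)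

theory Defs
  imports "HOL-Analysis.Analysis" "HOL-Probability.Essential_Supremum"
begin

text \<open>Real powers of extended nonnegative reals; only positive exponents \<open>a\<close> are used.\<close>

definition ennpowr :: "ennreal \<Rightarrow> real \<Rightarrow> ennreal" where
  "ennpowr x a = (if x = \<infinity> then \<infinity> else ennreal (enn2real x powr a))"

text \<open>The normalized surface measure: a Borel set \<open>A\<close> of unit vectors gets the proportion
  of the unit ball occupied by the cone \<open>{x. x / |x| \<in> A}\<close>. The function \<open>sgn\<close> maps \<open>x\<close> to
  \<open>x / |x|\<close> (and \<open>0\<close> to \<open>0\<close>, which is not in the sphere). The completion admits all
  Lebesgue measurable sets.\<close>

definition sphere_measure :: "'a::euclidean_space measure" where
  "sphere_measure =
     completion (restrict_space (distr (uniform_measure lborel (ball 0 1)) borel sgn) (sphere 0 1))"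

lemma space_sphere_measure: "space (sphere_measure :: 'a::euclidean_space measure) = sphere 0 1"
  by (simp add: sphere_measure_def space_restrict_space)

lemma emeasure_sphere_measure:
  fixes A :: "'a::euclidean_space set"
  assumes [measurable]: "A \<in> sets borel" and "A \<subseteq> sphere 0 1"
  shows "emeasure sphere_measure A =
    emeasure lborel {x \<in> ball 0 1. sgn x \<in> A} / emeasure lborel (ball 0 1 :: 'a set)"
proof -
  let ?D = "distr (uniform_measure lborel (ball 0 1)) borel (sgn :: 'a \<Rightarrow> 'a)"
  have "A \<in> sets (restrict_space ?D (sphere 0 1))"
    using assms by (auto simp: sets_restrict_space)
  hence "emeasure sphere_measure A = emeasure (restrict_space ?D (sphere 0 1)) A"
    unfolding sphere_measure_def by simp
  also have "\<dots> = emeasure ?D A"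
    using assms by (intro emeasure_restrict_space) auto
  also have "\<dots> = emeasure (uniform_measure lborel (ball 0 1)) (sgn -` A)"
    by (subst emeasure_distr) auto
  also have "\<dots> = emeasure lborel (ball 0 1 \<inter> sgn -` A) / emeasure lborel (ball 0 1 :: 'a set)"
  proof (rule emeasure_uniform_measure)
    have "sgn -` A \<inter> space lborel \<in> sets lborel"
      by measurable
    thus "sgn -` A \<in> sets lborel" by simp
  qed auto
  also have "ball 0 1 \<inter> sgn -` A = {x \<in> ball 0 1. sgn x \<in> A}" by auto
  finally show ?thesis .
qed

lemma emeasure_sphere_measure_sphere:
  "emeasure sphere_measure (sphere 0 1 :: 'a::euclidean_space set) = 1"
proof -
  have "emeasure lborel {x \<in> ball 0 1 :: 'a set. sgn x \<in> sphere 0 1}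
      = emeasure lborel (ball 0 1 - {0} :: 'a set)"
    by (rule arg_cong[where f = "emeasure lborel"]) (auto simp: norm_sgn)
  also have "\<dots> = emeasure lborel (ball 0 1 :: 'a set)"
    by (intro emeasure_Diff_null_set) auto
  finally have eq: "emeasure lborel {x \<in> ball 0 1 :: 'a set. sgn x \<in> sphere 0 1}
      = emeasure lborel (ball 0 1 :: 'a set)" .
  have "emeasure lborel (ball 0 1 :: 'a set) \<noteq> 0"
    using content_ball_pos[of 1 "0 :: 'a"] by (auto simp: measure_def)
  moreover have "emeasure lborel (ball 0 1 :: 'a set) \<noteq> \<infinity>"
    using emeasure_lborel_ball_finite[of "0 :: 'a" 1] by auto
  ultimately show ?thesis
    by (subst emeasure_sphere_measure) (simp_all only: eq ennreal_divide_self less_top borel_closed closed_sphere order_refl infinity_ennreal_def not_False_eq_True)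
qed

definition Lp_space :: "'a measure \<Rightarrow> ennreal \<Rightarrow> ('a \<Rightarrow> complex) set" where
  "Lp_space M s = {g \<in> borel_measurable M.
     if s = \<infinity> then esssup M (\<lambda>x. ennreal (norm (g x))) < \<infinity>
     else (\<integral>\<^sup>+x. ennreal (norm (g x) powr enn2real s) \<partial>M) < \<infinity>}"

definition homogeneous_degree_0 :: "('a::real_vector \<Rightarrow> 'b) \<Rightarrow> bool" where
  "homogeneous_degree_0 \<Omega> \<longleftrightarrow> (\<forall>t>0. \<forall>x. x \<noteq> 0 \<longrightarrow> \<Omega> (t *\<^sub>R x) = \<Omega> x)"

definition rough_integrand ::
    "('a::euclidean_space \<Rightarrow> complex) \<Rightarrow> real \<Rightarrow> ('a \<Rightarrow> complex) \<Rightarrow> 'a \<Rightarrow> 'a \<Rightarrow> complex" where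
  "rough_integrand \<Omega> \<alpha> f x y =
     \<Omega> (x - y) / of_real (norm (x - y) powr (real DIM('a) - \<alpha>)) * f y"

text \<open>The Bochner integral is \<open>0\<close> by convention where the integrand is not integrable, so
  claims about \<open>rough_op\<close> are to be accompanied by almost everywhere integrability.\<close>

definition rough_op ::
    "('a::euclidean_space \<Rightarrow> complex) \<Rightarrow> real \<Rightarrow> ('a \<Rightarrow> complex) \<Rightarrow> 'a \<Rightarrow> complex" where
  "rough_op \<Omega> \<alpha> f x = (LINT y|lebesgue. rough_integrand \<Omega> \<alpha> f x y)"

definition morrey_norm :: "real \<Rightarrow> real \<Rightarrow> ('a::euclidean_space \<Rightarrow> complex) \<Rightarrow> ennreal" where
  "morrey_norm p \<kappa> f = (SUP (c, r) \<in> UNIV \<times> {0<..}.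
     ennpowr ((\<integral>\<^sup>+x\<in>ball c r. ennreal (norm (f x) powr p) \<partial>lebesgue)
              / ennreal (measure lebesgue (ball c r) powr \<kappa>)) (1 / p))"

definition morrey_space :: "real \<Rightarrow> real \<Rightarrow> ('a::euclidean_space \<Rightarrow> complex) set" where
  "morrey_space p \<kappa> = {f \<in> borel_measurable lebesgue. morrey_norm p \<kappa> f < \<infinity>}"

definition weak_morrey_norm :: "real \<Rightarrow> real \<Rightarrow> ('a::euclidean_space \<Rightarrow> complex) \<Rightarrow> ennreal" where
  "weak_morrey_norm p \<kappa> f = (SUP (c, r) \<in> UNIV \<times> {0<..}.
     (SUP t\<in>{0<..}. ennreal t * ennpowr (emeasure lebesgue {x \<in> ball c r. norm (f x) > t}) (1 / p))
     / ennreal (measure lebesgue (ball c r) powr (\<kappa> / p)))"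

definition weak_morrey_space :: "real \<Rightarrow> real \<Rightarrow> ('a::euclidean_space \<Rightarrow> complex) set" where
  "weak_morrey_space p \<kappa> = {f \<in> borel_measurable lebesgue. weak_morrey_norm p \<kappa> f < \<infinity>}"

end

theory Submission
  imports Defs
begin

text \<open>
  By Hoelder's inequality on balls, \<open>\<integral>\<^bsub>B(x,r)\<^esub> |\<Omega>(x-y)| |f(y)| dy\<close> is controlled by
  \<open>\<integral>\<^bsub>B(x,r)\<^esub> |f|\<^sup>u\<close> with \<open>u = s'\<close>, because \<open>\<Omega>\<close> is homogeneous. Summing over dyadic annuli and splitting
  at the optimal radius gives Hedberg's inequality: if \<open>\<integral>\<^bsub>B(x,r)\<^esub> |f|\<^sup>u \<le> \<mu> r\<^sup>n\<close> for all \<open>r\<close>, then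
  \<open>|T f (x)|\<close> is at most a constant times \<open>\<mu>\<close> to the power \<open>p / (u q)\<close>, where \<open>f\<close> has Morrey norm 1. Hence where \<open>|T f|\<close>
  is large, some ball carries a large share of \<open>|f|\<^sup>u\<close>. Inside a ball of radius \<open>R\<close>, the Morrey condition
  forces such balls to have radius below \<open>R\<close> once \<open>\<mu>\<close> exceeds a multiple of a negative power of \<open>R\<close>, and the Vitali
  covering lemma bounds the measure of their union. This is the weak estimate; for \<open>u < p\<close>,
  truncating \<open>|f|\<^sup>u\<close> at height comparable to \<open>\<mu>\<close> and integrating over the levels gives the strong one.
\<close>

text \<open>The exponents come from scaling. The Morrey condition makes averages of
  \<open>|f|^u\<close> over balls of radius \<open>r\<close> at most a multiple of \<open>r\<close>
  to the power \<open>- \<gamma> * u\<close> with \<open>\<gamma> = n * (1 - \<kappa>) / p\<close>,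
  and the kernel gains \<open>r\<close> to the power \<open>\<alpha>\<close>. The hypotheses on
  \<open>\<kappa>\<close> and \<open>q\<close> amount to \<open>\<alpha> < \<gamma>\<close> and
  \<open>\<alpha> / \<gamma> = 1 - p / q\<close>; the former makes the sum over distant annuli
  converge, the latter yields the power of \<open>\<mu>\<close> at the balanced radius. The obstacle
  is locality: large values of \<open>T f\<close> may come from balls of any size, whereas a Morrey
  bound on a ball of radius \<open>R\<close> can use only the mass nearby. At levels too low to
  force small radii, the whole ball replaces the level set. This costs nothing, because at the
  critical level \<open>t powr q\<close> is comparable to \<open>R\<close> to the power
  \<open>- \<gamma> * p\<close>, and multiplied by \<open>R\<close> to the power \<open>n\<close>
  this is the permitted \<open>R\<close> to the power \<open>n * \<kappa>\<close>. For
  \<open>u = p\<close> the integral over the levels has the borderline weight \<open>1 / t\<close>,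
  so the argument stops at the weak bound.\<close>

section \<open>Hoelder's inequality and integration over level sets\<close>

lemma nn_integral_Holder:
  fixes f g :: "'a \<Rightarrow> real"
  assumes [measurable]: "f \<in> borel_measurable M" "g \<in> borel_measurable M"
    and nonneg: "\<And>x. 0 \<le> f x" "\<And>x. 0 \<le> g x"
    and ab: "1 < a" "1 < b" "1 / a + 1 / b = 1"
    and X: "(\<integral>\<^sup>+x. ennreal (f x powr a) \<partial>M) \<le> ennreal X" "0 \<le> X"
    and Y: "(\<integral>\<^sup>+x. ennreal (g x powr b) \<partial>M) \<le> ennreal Y" "0 \<le> Y"
  shows "(\<integral>\<^sup>+x. ennreal (f x * g x) \<partial>M) \<le> ennreal (X powr (1 / a) * Y powr (1 / b))"
proof -
  have degenerate: "(\<integral>\<^sup>+x. ennreal (f x * g x) \<partial>M) = 0"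
    if "(\<integral>\<^sup>+x. ennreal (h x powr c) \<partial>M) = 0" "h = f \<or> h = g" for h c
  proof -
    have [measurable]: "h \<in> borel_measurable M"
      using that(2) assms(1,2) by auto
    have "AE x in M. ennreal (h x powr c) = 0"
      using that(1) by (subst (asm) nn_integral_0_iff_AE) auto
    then have "AE x in M. h x = 0"
      by (auto simp: ennreal_eq_0_iff)
    then have "AE x in M. ennreal (f x * g x) = 0"
      by eventually_elim (use that(2) in auto)
    then show ?thesis
      by (subst nn_integral_0_iff_AE) auto
  qed
  \<comment> \<open>A zero bound forces the product to vanish almost everywhere; it is split off
    because the rescaling below divides by \<open>X\<close> and \<open>Y\<close>.\<close>
  consider "X = 0" | "Y = 0" | "X > 0" "Y > 0"
    using X(2) Y(2) by linarith
  then show ?thesis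
  proof cases
    case 1
    then show ?thesis using degenerate[of f a] X by auto
  next
    case 2
    then show ?thesis using degenerate[of g b] Y by auto
  next
    case 3
    define c where "c = X powr (1 / a) * Y powr (1 / b)"
    have c: "c > 0"
      using 3 by (simp add: c_def)
    \<comment> \<open>Young's inequality for the functions divided by \<open>X powr (1 / a)\<close>
      and \<open>Y powr (1 / b)\<close>; after integration the two terms add up to
      \<open>c * (1 / a + 1 / b) = c\<close>.\<close>
    have young: "f x * g x \<le> c / (a * X) * f x powr a + c / (b * Y) * g x powr b" for x
    proof -
      have "(f x / X powr (1 / a)) * (g x / Y powr (1 / b))
          \<le> (f x / X powr (1 / a)) powr a / a + (g x / Y powr (1 / b)) powr b / b"
        using ab nonneg by (intro Youngs_inequality) auto
      also have "\<dots> = f x powr a / (a * X) + g x powr b / (b * Y)"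
        using ab 3 nonneg by (simp add: powr_divide powr_powr field_simps)
      finally show ?thesis
        using c by (simp add: c_def field_simps)
    qed
    have "(\<integral>\<^sup>+x. ennreal (f x * g x) \<partial>M)
        \<le> (\<integral>\<^sup>+x. ennreal (c / (a * X)) * ennreal (f x powr a) + ennreal (c / (b * Y)) * ennreal (g x powr b) \<partial>M)"
      using young c ab 3
      by (intro nn_integral_mono) (auto simp flip: ennreal_mult ennreal_plus intro!: ennreal_leI)
    also have "\<dots> = ennreal (c / (a * X)) * (\<integral>\<^sup>+x. ennreal (f x powr a) \<partial>M)
        + ennreal (c / (b * Y)) * (\<integral>\<^sup>+x. ennreal (g x powr b) \<partial>M)"
      by (subst nn_integral_add) (auto simp: nn_integral_cmult)
    also have "\<dots> \<le> ennreal (c / (a * X)) * ennreal X + ennreal (c / (b * Y)) * ennreal Y"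
      by (intro add_mono mult_left_mono X Y) auto
    also have "\<dots> = ennreal (c / (a * X) * X + c / (b * Y) * Y)"
      using c ab 3 by (simp only: ennreal_mult[symmetric] ennreal_plus[symmetric] zero_le_mult_iff zero_le_divide_iff less_imp_le order.trans[OF zero_le_one] simp_thms)
    also have "c / (a * X) * X + c / (b * Y) * Y = c * (1 / a + 1 / b)"
      using 3 ab by (simp add: field_simps)
    finally show ?thesis
      by (simp add: c_def ab)
  qed
qed

lemma nn_integral_powr_from_0:
  fixes b c :: real
  assumes "0 < b" "0 \<le> c"
  shows "(\<integral>\<^sup>+t. (if 0 < t \<and> t < c then ennreal (t powr (b - 1)) else 0) \<partial>lborel) = ennreal (c powr b / b)"
proof -
  have "((\<lambda>x. x powr (b - 1)) has_integral c powr b / b) {0..c}"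
    using has_integral_powr_from_0[of "b - 1" c] assms by simp
  then have "(\<integral>\<^sup>+t. ennreal (t powr (b - 1)) * indicator {0..c} t \<partial>lborel) = ennreal (c powr b / b)"
    by (rule nn_integral_has_integral_lebesgue'[rotated]) auto
  moreover have "AE t in lborel. (if 0 < t \<and> t < c then ennreal (t powr (b - 1)) else 0)
      = ennreal (t powr (b - 1)) * indicator {0..c} t"
    using AE_lborel_singleton[of 0] AE_lborel_singleton[of c]
    by eventually_elim (auto simp: indicator_def)
  ultimately show ?thesis
    by (simp add: nn_integral_cong_AE)
qed

lemma nn_integral_powr_layer_cake:
  fixes H :: "'a::euclidean_space \<Rightarrow> real"
  assumes [measurable]: "H \<in> borel_measurable borel" "S \<in> sets borel"
    and H: "\<And>x. 0 \<le> H x" and q: "0 < q"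
  shows "(\<integral>\<^sup>+x\<in>S. ennreal (H x powr q) \<partial>lborel)
    = (\<integral>\<^sup>+t. (if 0 < t then ennreal (q * t powr (q - 1)) * emeasure lborel {x \<in> S. t < H x} else 0) \<partial>lborel)"
proof -
  have "(\<integral>\<^sup>+x\<in>S. ennreal (H x powr q) \<partial>lborel)
     = (\<integral>\<^sup>+x. \<integral>\<^sup>+t. (if x \<in> S \<and> 0 < t \<and> t < H x then ennreal (q * t powr (q - 1)) else 0) \<partial>lborel \<partial>lborel)"
  proof (rule nn_integral_cong)
    fix x
    have "ennreal (H x powr q) = ennreal q * ennreal (H x powr q / q)"
      using q by (simp flip: ennreal_mult)
    also have "\<dots> = ennreal q * (\<integral>\<^sup>+t. (if 0 < t \<and> t < H x then ennreal (t powr (q - 1)) else 0) \<partial>lborel)"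
      by (simp add: nn_integral_powr_from_0 q H)
    also have "\<dots> = (\<integral>\<^sup>+t. (if 0 < t \<and> t < H x then ennreal (q * t powr (q - 1)) else 0) \<partial>lborel)"
      using q by (subst nn_integral_cmult[symmetric]) (auto intro!: nn_integral_cong simp: ennreal_mult)
    finally show "ennreal (H x powr q) * indicator S x
      = (\<integral>\<^sup>+t. (if x \<in> S \<and> 0 < t \<and> t < H x then ennreal (q * t powr (q - 1)) else 0) \<partial>lborel)"
      by (cases "x \<in> S") auto
  qed
  also have "\<dots> = (\<integral>\<^sup>+t. \<integral>\<^sup>+x. (if x \<in> S \<and> 0 < t \<and> t < H x then ennreal (q * t powr (q - 1)) else 0) \<partial>lborel \<partial>lborel)"
    by (subst lborel_pair.Fubini') auto
  also have "\<dots> = (\<integral>\<^sup>+t. (if 0 < t then ennreal (q * t powr (q - 1)) * emeasure lborel {x \<in> S. t < H x} else 0) \<partial>lborel)"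
  proof (rule nn_integral_cong)
    fix t :: real
    have "(\<integral>\<^sup>+x. (if x \<in> S \<and> 0 < t \<and> t < H x then ennreal (q * t powr (q - 1)) else 0) \<partial>lborel)
       = (\<integral>\<^sup>+x. (if 0 < t then ennreal (q * t powr (q - 1)) else 0) * indicator {x \<in> S. t < H x} x \<partial>lborel)"
      by (intro nn_integral_cong) auto
    also have "\<dots> = (if 0 < t then ennreal (q * t powr (q - 1)) else 0) * emeasure lborel {x \<in> S. t < H x}"
      by (rule nn_integral_cmult_indicator) measurable
    finally show "(\<integral>\<^sup>+x. (if x \<in> S \<and> 0 < t \<and> t < H x then ennreal (q * t powr (q - 1)) else 0) \<partial>lborel)
       = (if 0 < t then ennreal (q * t powr (q - 1)) * emeasure lborel {x \<in> S. t < H x} else 0)"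
      by simp
  qed
  finally show ?thesis .
qed

text \<open>Since the truncation level moves with \<open>t\<close>, swapping the integrals leaves
  for each \<open>y\<close> the integral of \<open>t powr (q - 1 / \<theta> - 1)\<close> up to
  \<open>C * g y powr \<theta>\<close>. It converges at 0 because \<open>1 < q * \<theta>\<close>.
  Levels below \<open>t0\<close> contribute at most \<open>t0 powr q\<close> times the measure of
  \<open>S\<close>.\<close>

lemma strong_bound_from_truncated_weak_bound:
  fixes H g :: "'a::euclidean_space \<Rightarrow> real"
  assumes [measurable]: "H \<in> borel_measurable borel" "g \<in> borel_measurable borel"
      "S \<in> sets borel" "T \<in> sets borel"
    and H: "\<And>x. 0 \<le> H x" and g: "\<And>x. 0 \<le> g x"
    and par: "0 < q" "0 < \<theta>" "1 < q * \<theta>" "0 \<le> K" "0 \<le> C" "0 \<le> t0"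
    and weak: "\<And>t. 0 < t \<Longrightarrow> t0 \<le> t \<Longrightarrow> emeasure lborel {x \<in> S. t < H x}
      \<le> ennreal (K * t powr (- 1 / \<theta>)) * (\<integral>\<^sup>+y\<in>T. (if t < C * g y powr \<theta> then ennreal (g y) else 0) \<partial>lborel)"
  shows "(\<integral>\<^sup>+x\<in>S. ennreal (H x powr q) \<partial>lborel) \<le> ennreal (t0 powr q) * emeasure lborel S
    + ennreal (K * q / (q - 1 / \<theta>) * C powr (q - 1 / \<theta>)) * (\<integral>\<^sup>+y\<in>T. ennreal (g y powr (q * \<theta>)) \<partial>lborel)"
proof -
  have b: "0 < q - 1 / \<theta>"
    using par by (simp add: field_simps)
  \<comment> \<open>All factors are collected in one jointly measurable function, so that the order
    of integration can be exchanged later.\<close>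
  define h where "h t y = (if y \<in> T \<and> 0 < t \<and> t < C * g y powr \<theta> then ennreal (g y) * ennreal (K * q * t powr (q - 1 / \<theta> - 1)) else 0)" for t y
  have [measurable]: "(\<lambda>(y, t). h t y) \<in> borel_measurable (lborel \<Otimes>\<^sub>M lborel)"
    unfolding h_def by measurable
  have "(\<integral>\<^sup>+x\<in>S. ennreal (H x powr q) \<partial>lborel)
    = (\<integral>\<^sup>+t. (if 0 < t then ennreal (q * t powr (q - 1)) * emeasure lborel {x \<in> S. t < H x} else 0) \<partial>lborel)"
    by (rule nn_integral_powr_layer_cake) (use H par in auto)
  also have "\<dots> \<le> (\<integral>\<^sup>+t. ennreal q * emeasure lborel S * (if 0 < t \<and> t < t0 then ennreal (t powr (q - 1)) else 0)
      + (\<integral>\<^sup>+y. h t y \<partial>lborel) \<partial>lborel)"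
  proof (rule nn_integral_mono)
    fix t :: real
    consider "t \<le> 0" | "0 < t" "t < t0" | "0 < t" "t0 \<le> t"
      by linarith
    then show "(if 0 < t then ennreal (q * t powr (q - 1)) * emeasure lborel {x \<in> S. t < H x} else 0)
       \<le> ennreal q * emeasure lborel S * (if 0 < t \<and> t < t0 then ennreal (t powr (q - 1)) else 0)
      + (\<integral>\<^sup>+y. h t y \<partial>lborel)"
    proof cases
      case 2
      have "emeasure lborel {x \<in> S. t < H x} \<le> emeasure lborel S"
        by (intro emeasure_mono) auto
      then have "ennreal (q * t powr (q - 1)) * emeasure lborel {x \<in> S. t < H x}
          \<le> ennreal (q * t powr (q - 1)) * emeasure lborel S"
        by (intro mult_left_mono) auto
      also have "\<dots> = ennreal q * emeasure lborel S * ennreal (t powr (q - 1))"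
        using par by (simp add: ennreal_mult mult_ac)
      finally show ?thesis
        using 2 by (simp add: add_increasing2)
    next
      case 3
      have "ennreal (q * t powr (q - 1)) * emeasure lborel {x \<in> S. t < H x}
          \<le> ennreal (q * t powr (q - 1)) * (ennreal (K * t powr (- 1 / \<theta>)) * (\<integral>\<^sup>+y\<in>T. (if t < C * g y powr \<theta> then ennreal (g y) else 0) \<partial>lborel))"
        by (intro mult_left_mono weak 3) auto
      also have "\<dots> = ennreal (K * q * t powr (q - 1 / \<theta> - 1)) * (\<integral>\<^sup>+y\<in>T. (if t < C * g y powr \<theta> then ennreal (g y) else 0) \<partial>lborel)"
      proof -
        have "t powr (q - 1) * t powr (- 1 / \<theta>) = t powr (q - 1 / \<theta> - 1)"
          by (simp flip: powr_add add: algebra_simps)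
        then have "q * t powr (q - 1) * (K * t powr (- 1 / \<theta>)) = K * q * t powr (q - 1 / \<theta> - 1)"
          by (simp add: algebra_simps)
        then show ?thesis
          using par by (simp only: mult.assoc[symmetric] ennreal_mult[symmetric] zero_le_mult_iff powr_ge_zero less_imp_le simp_thms)
      qed
      also have "\<dots> = (\<integral>\<^sup>+y. h t y \<partial>lborel)"
        using 3 by (subst nn_integral_cmult[symmetric]) (auto intro!: nn_integral_cong simp: h_def mult.commute)
      finally show ?thesis
        using 3 by simp
    qed auto
  qed
  also have "\<dots> = (\<integral>\<^sup>+t. ennreal q * emeasure lborel S * (if 0 < t \<and> t < t0 then ennreal (t powr (q - 1)) else 0) \<partial>lborel)
      + (\<integral>\<^sup>+t. \<integral>\<^sup>+y. h t y \<partial>lborel \<partial>lborel)"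
    by (rule nn_integral_add) measurable
  also have "(\<integral>\<^sup>+t. ennreal q * emeasure lborel S * (if 0 < t \<and> t < t0 then ennreal (t powr (q - 1)) else 0) \<partial>lborel)
      = ennreal q * emeasure lborel S * ennreal (t0 powr q / q)"
    using par by (subst nn_integral_cmult) (auto simp: nn_integral_powr_from_0)
  also have "\<dots> = ennreal (q * (t0 powr q / q)) * emeasure lborel S"
    using par by (subst ennreal_mult) (auto simp: mult_ac)
  also have "q * (t0 powr q / q) = t0 powr q"
    using par by simp
  also have "(\<integral>\<^sup>+t. \<integral>\<^sup>+y. h t y \<partial>lborel \<partial>lborel) = (\<integral>\<^sup>+y. \<integral>\<^sup>+t. h t y \<partial>lborel \<partial>lborel)"
    by (rule lborel_pair.Fubini') measurable
  also have "\<dots> = (\<integral>\<^sup>+y. ennreal (K * q / (q - 1 / \<theta>) * C powr (q - 1 / \<theta>)) * (ennreal (g y powr (q * \<theta>)) * indicator T y) \<partial>lborel)"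
  proof (rule nn_integral_cong)
    fix y
    show "(\<integral>\<^sup>+t. h t y \<partial>lborel) = ennreal (K * q / (q - 1 / \<theta>) * C powr (q - 1 / \<theta>)) * (ennreal (g y powr (q * \<theta>)) * indicator T y)"
    proof (cases "y \<in> T")
      case True
      have "(\<integral>\<^sup>+t. h t y \<partial>lborel) = (\<integral>\<^sup>+t. ennreal (g y * (K * q)) *
          (if 0 < t \<and> t < C * g y powr \<theta> then ennreal (t powr (q - 1 / \<theta> - 1)) else 0) \<partial>lborel)"
        using True par g by (intro nn_integral_cong) (auto simp: h_def ennreal_mult mult_ac)
      also have "\<dots> = ennreal (g y * (K * q)) * ennreal ((C * g y powr \<theta>) powr (q - 1 / \<theta>) / (q - 1 / \<theta>))"
        using par b by (subst nn_integral_cmult) (auto simp: nn_integral_powr_from_0)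
      also have "\<dots> = ennreal ((g y * (K * q)) * ((C * g y powr \<theta>) powr (q - 1 / \<theta>) / (q - 1 / \<theta>)))"
        using par g b by (subst ennreal_mult) auto
      also have "(g y * (K * q)) * ((C * g y powr \<theta>) powr (q - 1 / \<theta>) / (q - 1 / \<theta>))
          = K * q / (q - 1 / \<theta>) * C powr (q - 1 / \<theta>) * g y powr (q * \<theta>)"
      proof -
        \<comment> \<open>The factor \<open>g y\<close> left over from the truncated integral raises
          the exponent from \<open>q * \<theta> - 1\<close> to \<open>q * \<theta>\<close>; where
          \<open>g y\<close> vanishes both sides are 0, as \<open>0 powr a = 0\<close>.\<close>
        have "g y * g y powr (q * \<theta> - 1) = g y powr (q * \<theta>)"
          using g[of y] by (cases "g y = 0") (auto simp: powr_mult_base)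
        moreover have "(C * g y powr \<theta>) powr (q - 1 / \<theta>) = C powr (q - 1 / \<theta>) * g y powr (q * \<theta> - 1)"
          using par by (simp add: powr_mult powr_powr algebra_simps)
        ultimately show ?thesis
          by (simp add: mult_ac)
      qed
      also have "ennreal \<dots> = ennreal (K * q / (q - 1 / \<theta>) * C powr (q - 1 / \<theta>)) * ennreal (g y powr (q * \<theta>))"
        using par b by (subst ennreal_mult) auto
      finally show ?thesis
        using True by simp
    qed (simp add: h_def)
  qed
  also have "\<dots> = ennreal (K * q / (q - 1 / \<theta>) * C powr (q - 1 / \<theta>)) * (\<integral>\<^sup>+y\<in>T. ennreal (g y powr (q * \<theta>)) \<partial>lborel)"
    by (rule nn_integral_cmult) measurable
  finally show ?thesis .
qed

section \<open>Vitali covering bounds for points with a dense ball\<close>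

text \<open>Disjoint balls are selected whose fivefold enlargements cover \<open>S\<close>. The
  volume of each enlargement is at most \<open>5 ^ n * unit_ball_vol n / \<mu>\<close> times the
  mass of \<open>g\<close> in the small ball, and disjointness lets the masses be added. The
  restriction \<open>r < R\<close> serves twice: it bounds the radii for Vitali's lemma and keeps
  all balls inside the doubled ball.\<close>

lemma maximal_weak_bound:
  fixes g :: "'a::euclidean_space \<Rightarrow> real"
  assumes [measurable]: "g \<in> borel_measurable borel" "S \<in> sets borel"
    and mu: "0 < \<mu>" and S: "S \<subseteq> ball c R"
    and large: "\<And>x. x \<in> S \<Longrightarrow> \<exists>r>0. r < R \<and> ennreal (\<mu> * r powr DIM('a)) \<le> (\<integral>\<^sup>+y\<in>ball x r. ennreal (g y) \<partial>lborel)"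
  shows "emeasure lborel S \<le> ennreal (5 ^ DIM('a) * unit_ball_vol DIM('a) / \<mu>) * (\<integral>\<^sup>+y\<in>ball c (2 * R). ennreal (g y) \<partial>lborel)"
proof -
  have [measurable]: "ball a s \<in> sets borel" for a :: 'a and s
    by simp
  obtain r where r: "\<And>x. x \<in> S \<Longrightarrow> 0 < r x \<and> r x < R \<and>
      ennreal (\<mu> * r x powr DIM('a)) \<le> (\<integral>\<^sup>+y\<in>ball x (r x). ennreal (g y) \<partial>lborel)"
    using large by metis
  obtain C where C: "countable C" "C \<subseteq> S"
     "pairwise (\<lambda>i j. disjnt (cball i (r i)) (cball j (r j))) C"
     "\<And>i. i \<in> S \<Longrightarrow> \<exists>j. j \<in> C \<and> \<not> disjnt (cball i (r i)) (cball j (r j)) \<and> cball i (r i) \<subseteq> ball j (5 * r j)"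
  proof (rule Vitali_covering_lemma_cballs_balls[of S r R "\<lambda>x. x"])
    show "0 < r x \<and> r x \<le> R" if "x \<in> S" for x
      using r[OF that] by simp
  qed blast
  have disj: "disjoint_family_on (\<lambda>j. ball j (r j)) C"
    using C(3) ball_subset_cball unfolding disjoint_family_on_def pairwise_def disjnt_def by blast
  let ?w = "unit_ball_vol DIM('a)"
  have "S \<subseteq> (\<Union>j\<in>C. ball j (5 * r j))"
  proof
    fix x assume "x \<in> S"
    then obtain j where "j \<in> C" "cball x (r x) \<subseteq> ball j (5 * r j)"
      using C(4) by blast
    moreover have "x \<in> cball x (r x)"
      using r[OF \<open>x \<in> S\<close>] by auto
    ultimately show "x \<in> (\<Union>j\<in>C. ball j (5 * r j))" by blast
  qed
  then have "emeasure lborel S \<le> emeasure lborel (\<Union>j\<in>C. ball j (5 * r j))"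
    using C(1) by (intro emeasure_mono) auto
  \<comment> \<open>The sum over the countable set of centres is an integral over
    \<open>count_space C\<close>; subadditivity follows by comparing indicators pointwise and
    exchanging the integrals.\<close>
  also have "\<dots> \<le> (\<integral>\<^sup>+j. emeasure lborel (ball j (5 * r j)) \<partial>count_space C)"
  proof -
    have "emeasure lborel (\<Union>j\<in>C. ball j (5 * r j)) = (\<integral>\<^sup>+x. indicator (\<Union>j\<in>C. ball j (5 * r j)) x \<partial>lborel)"
      using C(1) by (intro nn_integral_indicator[symmetric]) auto
    also have "\<dots> \<le> (\<integral>\<^sup>+x. (\<integral>\<^sup>+j. indicator (ball j (5 * r j)) x \<partial>count_space C) \<partial>lborel)"
    proof (rule nn_integral_mono)
      fix x
      show "(indicator (\<Union>j\<in>C. ball j (5 * r j)) x :: ennreal) \<le> (\<integral>\<^sup>+j. indicator (ball j (5 * r j)) x \<partial>count_space C)"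
      proof (cases "x \<in> (\<Union>j\<in>C. ball j (5 * r j))")
        case True
        then obtain i where i: "i \<in> C" "x \<in> ball i (5 * r i)" by blast
        then have "indicator (ball i (5 * r i)) x \<le> (\<integral>\<^sup>+j. (indicator (ball j (5 * r j)) x :: ennreal) \<partial>count_space C)"
          by (intro nn_integral_ge_point)
        then show ?thesis using i by (auto simp: indicator_def)
      qed auto
    qed
    also have "\<dots> = (\<integral>\<^sup>+j. (\<integral>\<^sup>+x. indicator (ball j (5 * r j)) x \<partial>lborel) \<partial>count_space C)"
      by (rule nn_integral_count_space_nn_integral[OF C(1)]) measurable
    finally show ?thesis by simp
  qed
  also have "\<dots> \<le> (\<integral>\<^sup>+j. ennreal (5 ^ DIM('a) * ?w / \<mu>) * (\<integral>\<^sup>+y\<in>ball j (r j). ennreal (g y) \<partial>lborel) \<partial>count_space C)"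
  proof (rule nn_integral_mono)
    fix j assume "j \<in> space (count_space C)"
    then have j: "0 < r j" "ennreal (\<mu> * r j powr DIM('a)) \<le> (\<integral>\<^sup>+y\<in>ball j (r j). ennreal (g y) \<partial>lborel)"
      using r C(2) by auto
    have "emeasure lborel (ball j (5 * r j)) = ennreal (?w * (5 * r j) ^ DIM('a))"
      using j by (simp add: emeasure_ball)
    also have "?w * (5 * r j) ^ DIM('a) = 5 ^ DIM('a) * ?w / \<mu> * (\<mu> * r j powr DIM('a))"
      using j mu by (simp add: power_mult_distrib powr_realpow)
    also have "ennreal \<dots> = ennreal (5 ^ DIM('a) * ?w / \<mu>) * ennreal (\<mu> * r j powr DIM('a))"
      using mu by (subst ennreal_mult) auto
    also have "\<dots> \<le> ennreal (5 ^ DIM('a) * ?w / \<mu>) * (\<integral>\<^sup>+y\<in>ball j (r j). ennreal (g y) \<partial>lborel)"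
      by (intro mult_left_mono j) auto
    finally show "emeasure lborel (ball j (5 * r j)) \<le> \<dots>" .
  qed
  also have "\<dots> = ennreal (5 ^ DIM('a) * ?w / \<mu>) * (\<integral>\<^sup>+j. (\<integral>\<^sup>+y\<in>ball j (r j). ennreal (g y) \<partial>lborel) \<partial>count_space C)"
    by (rule nn_integral_cmult) auto
  \<comment> \<open>Reading the masses as values of the measure with density \<open>g\<close> makes
    countable additivity over the disjoint balls available.\<close>
  also have "(\<integral>\<^sup>+j. (\<integral>\<^sup>+y\<in>ball j (r j). ennreal (g y) \<partial>lborel) \<partial>count_space C)
      = (\<integral>\<^sup>+j. emeasure (density lborel g) (ball j (r j)) \<partial>count_space C)"
    by (intro nn_integral_cong) (simp add: emeasure_density)
  also have "\<dots> = emeasure (density lborel g) (\<Union>j\<in>C. ball j (r j))"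
    using C(1) disj by (intro emeasure_UN_countable[symmetric]) auto
  also have "\<dots> \<le> emeasure (density lborel g) (ball c (2 * R))"
  proof (rule emeasure_mono)
    have "ball j (r j) \<subseteq> ball c (2 * R)" if "j \<in> C" for j
    proof
      fix y assume "y \<in> ball j (r j)"
      moreover have "dist c j < R" "r j < R"
        using that C(2) S r by auto
      ultimately show "y \<in> ball c (2 * R)"
        using dist_triangle[of c y j] by simp
    qed
    then show "(\<Union>j\<in>C. ball j (r j)) \<subseteq> ball c (2 * R)" by blast
  qed auto
  also have "\<dots> = (\<integral>\<^sup>+y\<in>ball c (2 * R). ennreal (g y) \<partial>lborel)"
    by (simp add: emeasure_density)
  finally show ?thesis
    by (simp add: mult_left_mono)
qed

text \<open>The part of \<open>g\<close> below \<open>\<mu> / (2 |B|)\<close>, with \<open>|B|\<close> the volume of the unit ball, accounts for at most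
  half of an integral exceeding \<open>\<mu> r\<^sup>n\<close>.\<close>

lemma maximal_weak_bound_truncated:
  fixes g :: "'a::euclidean_space \<Rightarrow> real"
  assumes [measurable]: "g \<in> borel_measurable borel" "S \<in> sets borel"
    and g: "\<And>x. 0 \<le> g x"
    and mu: "0 < \<mu>" and S: "S \<subseteq> ball c R"
    and large: "\<And>x. x \<in> S \<Longrightarrow> \<exists>r>0. r < R \<and> ennreal (\<mu> * r powr DIM('a)) \<le> (\<integral>\<^sup>+y\<in>ball x r. ennreal (g y) \<partial>lborel)"
  shows "emeasure lborel S \<le> ennreal (2 * 5 ^ DIM('a) * unit_ball_vol DIM('a) / \<mu>)
    * (\<integral>\<^sup>+y\<in>ball c (2 * R). (if \<mu> < 2 * unit_ball_vol DIM('a) * g y then ennreal (g y) else 0) \<partial>lborel)"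
proof -
  have [measurable]: "ball a s \<in> sets borel" for a :: 'a and s
    by simp
  let ?w = "unit_ball_vol DIM('a)"
  have w: "?w > 0" by simp
  define h where "h y = (if \<mu> < 2 * ?w * g y then g y else 0)" for y
  have [measurable]: "h \<in> borel_measurable borel"
    unfolding h_def by measurable
  have h: "0 \<le> h y" "g y \<le> \<mu> / (2 * ?w) + h y" for y
    using g[of y] mu w by (auto simp: h_def field_simps)
  have "\<exists>r>0. r < R \<and> ennreal (\<mu> / 2 * r powr DIM('a)) \<le> (\<integral>\<^sup>+y\<in>ball x r. ennreal (h y) \<partial>lborel)"
    if "x \<in> S" for x
  proof -
    obtain r where r: "r > 0" "r < R" "ennreal (\<mu> * r powr DIM('a)) \<le> (\<integral>\<^sup>+y\<in>ball x r. ennreal (g y) \<partial>lborel)"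
      using large[OF \<open>x \<in> S\<close>] by blast
    \<comment> \<open>The mass is split into two equal finite halves: the part of \<open>g\<close>
      below the truncation level uses up one of them, and the finite half can be cancelled.\<close>
    have "ennreal (\<mu> / 2 * r powr DIM('a)) + ennreal (\<mu> / 2 * r powr DIM('a)) = ennreal (\<mu> * r powr DIM('a))"
      using mu by (simp flip: ennreal_plus)
    also note r(3)
    also have "(\<integral>\<^sup>+y\<in>ball x r. ennreal (g y) \<partial>lborel)
       \<le> (\<integral>\<^sup>+y. ennreal (\<mu> / (2 * ?w)) * indicator (ball x r) y + ennreal (h y) * indicator (ball x r) y \<partial>lborel)"
      using h mu w by (intro nn_integral_mono)
        (auto simp: indicator_def simp flip: ennreal_plus intro!: ennreal_leI)
    also have "\<dots> = ennreal (\<mu> / (2 * ?w)) * emeasure lborel (ball x r) + (\<integral>\<^sup>+y\<in>ball x r. ennreal (h y) \<partial>lborel)"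
      by (subst nn_integral_add) (measurable, simp add: nn_integral_cmult_indicator)
    also have "ennreal (\<mu> / (2 * ?w)) * emeasure lborel (ball x r) = ennreal (\<mu> / 2 * r powr DIM('a))"
      using r mu less_imp_neq[OF w, symmetric] by (simp add: emeasure_ball powr_realpow flip: ennreal_mult)
    finally have "ennreal (\<mu> / 2 * r powr DIM('a)) \<le> (\<integral>\<^sup>+y\<in>ball x r. ennreal (h y) \<partial>lborel)"
      by (simp add: ennreal_add_left_cancel_le)
    then show ?thesis using r by blast
  qed
  then have "emeasure lborel S \<le> ennreal (5 ^ DIM('a) * ?w / (\<mu> / 2)) * (\<integral>\<^sup>+y\<in>ball c (2 * R). ennreal (h y) \<partial>lborel)"
    using mu S by (intro maximal_weak_bound) auto
  also have "(\<integral>\<^sup>+y\<in>ball c (2 * R). ennreal (h y) \<partial>lborel)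
      = (\<integral>\<^sup>+y\<in>ball c (2 * R). (if \<mu> < 2 * ?w * g y then ennreal (g y) else 0) \<partial>lborel)"
    by (intro nn_integral_cong) (auto simp: h_def)
  finally show ?thesis
    by (simp add: mult_ac)
qed

section \<open>Dyadic scales and lower powers on balls\<close>

lemma dyadic_scale_exists:
  fixes z :: real
  assumes "0 < z"
  obtains k :: nat where "2 powr (- real k - 1) \<le> z" "z < 2 powr (- real k)"
  | k :: nat where "2 powr real k \<le> z" "z < 2 powr (real k + 1)"
proof -
  define m where "m = \<lfloor>log 2 z\<rfloor>"
  have m: "2 powr m \<le> z" "z < 2 powr (m + 1)"
    using assms by (simp_all add: m_def powr_le_iff less_powr_iff)
  show thesis
  proof (cases "0 \<le> m")
    case True
    then show ?thesis
      using m that(2)[of "nat m"] by simp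
  next
    case False
    \<comment> \<open>The shift by one makes natural indices start at \<open>[1/2, 1)\<close> below
      1, as they start at \<open>[1, 2)\<close> above, so near and far annuli can share one series
      index.\<close>
    define k where "k = nat (- m - 1)"
    have "- real k - 1 = m" "- real k = m + 1"
      using False by (simp_all add: k_def)
    with m show ?thesis
      using that(1)[of k] by metis
  qed
qed

text \<open>Hoelder's inequality against the indicator of the ball, with exponents
  \<open>p / u\<close> and \<open>p / (p - u)\<close>. For \<open>u = p\<close> the second exponent
  degenerates and the bound is the hypothesis itself.\<close>

lemma nn_integral_ball_power_mono:
  fixes F :: "'a::euclidean_space \<Rightarrow> real"
  assumes [measurable]: "F \<in> borel_measurable borel"
    and F: "\<And>y. 0 \<le> F y" and u: "0 < u" "u \<le> p" and r: "0 < r"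
    and X: "(\<integral>\<^sup>+y\<in>ball x r. ennreal (F y powr p) \<partial>lborel) \<le> ennreal X" "0 \<le> X"
  shows "(\<integral>\<^sup>+y\<in>ball x r. ennreal (F y powr u) \<partial>lborel)
    \<le> ennreal (X powr (u / p) * (unit_ball_vol DIM('a) * r powr DIM('a)) powr (1 - u / p))"
proof (cases "u = p")
  case True
  then show ?thesis
    using X u r less_imp_neq[OF unit_ball_vol_pos, of "DIM('a)"] by simp
next
  case False
  have [measurable]: "ball x r \<in> sets borel" by simp
  let ?i = "indicator (ball x r) :: 'a \<Rightarrow> real"
  have u': "u < p" "0 < p" using u False by auto
  have "(\<integral>\<^sup>+y. ennreal ((F y powr u * ?i y) * ?i y) \<partial>lborel)
     \<le> ennreal (X powr (1 / (p / u)) * (unit_ball_vol DIM('a) * r powr DIM('a)) powr (1 / (p / (p - u))))"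
  proof (rule nn_integral_Holder)
    have "(\<integral>\<^sup>+y. ennreal ((F y powr u * ?i y) powr (p / u)) \<partial>lborel) = (\<integral>\<^sup>+y\<in>ball x r. ennreal (F y powr p) \<partial>lborel)"
      using u F by (intro nn_integral_cong) (auto simp: indicator_def powr_powr)
    then show "(\<integral>\<^sup>+y. ennreal ((F y powr u * ?i y) powr (p / u)) \<partial>lborel) \<le> ennreal X"
      using X by simp
    have "(\<integral>\<^sup>+y. ennreal (?i y powr (p / (p - u))) \<partial>lborel) = (\<integral>\<^sup>+y. indicator (ball x r) y \<partial>lborel)"
      by (intro nn_integral_cong) (auto simp: indicator_def)
    then show "(\<integral>\<^sup>+y. ennreal (?i y powr (p / (p - u))) \<partial>lborel) \<le> ennreal (unit_ball_vol DIM('a) * r powr DIM('a))"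
      using r by (simp add: emeasure_ball powr_realpow)
  qed (use u' u X F in \<open>auto simp: field_simps\<close>)
  also have "(\<integral>\<^sup>+y. ennreal ((F y powr u * ?i y) * ?i y) \<partial>lborel) = (\<integral>\<^sup>+y\<in>ball x r. ennreal (F y powr u) \<partial>lborel)"
    by (intro nn_integral_cong) (auto simp: indicator_def)
  also have "1 / (p / (p - u)) = 1 - u / p"
    using u' by (simp add: field_simps)
  finally show ?thesis
    by simp
qed

section \<open>Potentials of kernels with a local Hoelder bound\<close>

text \<open>The kernel enters only through \<open>local_bound\<close>, the form that Hoelder's
  inequality takes for a homogeneous \<open>W\<close>. This treats \<open>s = \<infinity>\<close>,
  where \<open>u = 1\<close>, together with finite \<open>s\<close>; \<open>A\<close> stands for a
  bound on the size of \<open>W\<close> on the sphere.\<close>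

locale rough_kernel =
  fixes W :: "'a::euclidean_space \<Rightarrow> real" and \<alpha> \<kappa> p q u A :: real
  assumes W_measurable [measurable]: "W \<in> borel_measurable borel"
    and W_nonneg: "\<And>z. 0 \<le> W z"
    and alpha: "0 < \<alpha>" "\<alpha> < DIM('a)"
    and exponents: "1 \<le> u" "u \<le> p" "p < q"
    and kappa: "0 < \<kappa>" "\<kappa> < 1 - \<alpha> * p / DIM('a)"
    and q_eq: "1 / q = 1 / p - \<alpha> / (DIM('a) * (1 - \<kappa>))"
    and A_pos: "0 < A"
    and local_bound: "\<And>F x r v. F \<in> borel_measurable borel \<Longrightarrow> (\<And>y. 0 \<le> F y) \<Longrightarrow> 0 < r \<Longrightarrow> 0 \<le> v
      \<Longrightarrow> (\<integral>\<^sup>+y\<in>ball x r. ennreal (F y powr u) \<partial>lborel) \<le> ennreal v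
      \<Longrightarrow> (\<integral>\<^sup>+y\<in>ball x r. ennreal (W (x - y) * F y) \<partial>lborel)
        \<le> ennreal (A * r powr (DIM('a) - DIM('a) / u) * v powr (1 / u))"
begin

text \<open>The operator with absolute values inside. Extended values make it meaningful at every
  point, before integrability is known.\<close>

definition potential :: "('a \<Rightarrow> real) \<Rightarrow> 'a \<Rightarrow> ennreal" where
  "potential F x = (\<integral>\<^sup>+y. ennreal (W (x - y) / norm (x - y) powr (DIM('a) - \<alpha>) * F y) \<partial>lborel)"

text \<open>The Morrey norm is normalized with powers of the radius in place of powers of the ball's
  measure; the missing power of the unit ball volume is restored when \<open>f\<close> is
  rescaled.\<close>

definition morrey_unit :: "('a \<Rightarrow> real) \<Rightarrow> bool" where
  "morrey_unit F \<longleftrightarrow> F \<in> borel_measurable borel \<and> (\<forall>y. 0 \<le> F y) \<and>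
    (\<forall>x r. 0 < r \<longrightarrow> (\<integral>\<^sup>+y\<in>ball x r. ennreal (F y powr p) \<partial>lborel) \<le> ennreal (r powr (DIM('a) * \<kappa>)))"

lemma morrey_unitD:
  assumes "morrey_unit F"
  shows "F \<in> borel_measurable borel" "0 \<le> F y"
    "0 < r \<Longrightarrow> (\<integral>\<^sup>+y\<in>ball x r. ennreal (F y powr p) \<partial>lborel) \<le> ennreal (r powr (DIM('a) * \<kappa>))"
  using assms by (auto simp: morrey_unit_def)

lemma potential_measurable [measurable]:
  assumes [measurable]: "F \<in> borel_measurable borel"
  shows "potential F \<in> borel_measurable borel"
  unfolding potential_def by measurable

text \<open>The decay rate of averages: the Morrey condition bounds the \<open>L^p\<close> mean of
  \<open>F\<close> over a ball by a multiple of \<open>r powr (- \<gamma>)\<close>.\<close>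

definition \<gamma> :: real where "\<gamma> = DIM('a) * (1 - \<kappa>) / p"
text \<open>The exponent in Hedberg's inequality; it equals
  \<open>(1 - \<alpha> / \<gamma>) / u\<close>.\<close>

definition \<theta> :: real where "\<theta> = p / (u * q)"
definition vol :: real where "vol = unit_ball_vol DIM('a)"
text \<open>Two geometric series: ratio \<open>2 powr (- \<alpha>)\<close> for annuli inside the
  splitting radius, ratio \<open>2 powr (\<alpha> - \<gamma>)\<close> outside. The numerators carry
  a power of 2 because the kernel is evaluated at the inner radius of an annulus and the mass on the
  ball of its outer radius.\<close>

definition Cp :: real where
  "Cp = A * 2 powr (DIM('a) - \<alpha>) / (1 - 2 powr (- \<alpha>))
    + A * (vol powr (1 - u / p)) powr (1 / u) * 2 powr (DIM('a) - \<gamma>) / (1 - 2 powr (\<alpha> - \<gamma>))"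

lemma vol_pos: "0 < vol"
  by (simp add: vol_def)

lemma pos: "0 < u" "0 < p" "0 < q"
  using exponents by auto

text \<open>The hypotheses on \<open>\<kappa>\<close> and \<open>q\<close> rewritten in terms of
  \<open>\<gamma>\<close>: convergence of the far series, the exponent of Hedberg's inequality, and
  the identity that combines \<open>R powr (- (\<gamma> * p))\<close> with the volume of a
  ball.\<close>

lemma gamma: "\<alpha> < \<gamma>" "\<alpha> / \<gamma> = 1 - p / q" "\<gamma> * p = DIM('a) * (1 - \<kappa>)"
proof -
  have d: "0 < real DIM('a)" by simp
  have k: "\<alpha> * p < DIM('a) * (1 - \<kappa>)"
    using kappa(2) d by (simp add: field_simps)
  then show "\<alpha> < \<gamma>"
    using pos by (simp add: \<gamma>_def field_simps)
  have "0 < \<alpha> * p"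
    using alpha pos by simp
  with k have "0 < 1 - \<kappa>"
    using d by (smt (verit) zero_less_mult_pos)
  then show "\<alpha> / \<gamma> = 1 - p / q"
    using q_eq pos by (simp add: \<gamma>_def divide_simps) (simp add: algebra_simps)
  show "\<gamma> * p = DIM('a) * (1 - \<kappa>)"
    using pos by (simp add: \<gamma>_def)
qed


lemma morrey_unit_powr_u:
  assumes F: "morrey_unit F" and r: "0 < r"
  shows "(\<integral>\<^sup>+y\<in>ball x r. ennreal (F y powr u) \<partial>lborel)
    \<le> ennreal (vol powr (1 - u / p) * r powr (DIM('a) - \<gamma> * u))"
proof -
  have "(\<integral>\<^sup>+y\<in>ball x r. ennreal (F y powr u) \<partial>lborel)
    \<le> ennreal ((r powr (DIM('a) * \<kappa>)) powr (u / p) * (unit_ball_vol DIM('a) * r powr DIM('a)) powr (1 - u / p))"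
    using pos exponents r by (intro nn_integral_ball_power_mono morrey_unitD[OF F]) auto
  also have "(r powr (DIM('a) * \<kappa>)) powr (u / p) * (unit_ball_vol DIM('a) * r powr DIM('a)) powr (1 - u / p)
     = vol powr (1 - u / p) * r powr (DIM('a) * \<kappa> * (u / p) + DIM('a) * (1 - u / p))"
    using vol_pos r by (simp add: vol_def powr_mult powr_powr powr_add)
  also have "DIM('a) * \<kappa> * (u / p) + DIM('a) * (1 - u / p) = DIM('a) - \<gamma> * u"
    using pos by (simp add: \<gamma>_def field_simps)
  finally show ?thesis .
qed

text \<open>Each \<open>y\<close> different from \<open>x\<close> lies in one dyadic annulus, where
  the decreasing power of the distance is at most its value at the inner radius. One term of the
  series is therefore enough, and full balls may replace annuli because that only enlarges the
  sum.\<close>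

lemma kernel_dyadic_bound:
  assumes \<delta>: "0 < \<delta>" and F: "0 \<le> F y"
  shows "ennreal (W (x - y) / norm (x - y) powr (DIM('a) - \<alpha>) * F y)
    \<le> (\<Sum>k. ennreal ((2 powr (- real k - 1) * \<delta>) powr (\<alpha> - DIM('a))) * (ennreal (W (x - y) * F y) * indicator (ball x (2 powr (- real k) * \<delta>)) y)
          + ennreal ((2 powr real k * \<delta>) powr (\<alpha> - DIM('a))) * (ennreal (W (x - y) * F y) * indicator (ball x (2 powr (real k + 1) * \<delta>)) y))"
    (is "_ \<le> (\<Sum>k. ?near k + ?far k)")
proof (cases "x = y")
  case False
  then have z: "0 < norm (x - y) / \<delta>"
    using \<delta> by simp
  have kernel: "ennreal (W (x - y) / norm (x - y) powr (DIM('a) - \<alpha>) * F y)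
      \<le> ennreal (\<rho> powr (\<alpha> - DIM('a))) * ennreal (W (x - y) * F y)"
    if "0 < \<rho>" "\<rho> \<le> norm (x - y)" for \<rho>
  proof -
    have "norm (x - y) powr (\<alpha> - DIM('a)) \<le> \<rho> powr (\<alpha> - DIM('a))"
      using that alpha by (intro powr_mono2') auto
    then have "W (x - y) * F y * norm (x - y) powr (\<alpha> - DIM('a)) \<le> W (x - y) * F y * \<rho> powr (\<alpha> - DIM('a))"
      using W_nonneg F by (intro mult_left_mono) auto
    moreover have "W (x - y) / norm (x - y) powr (DIM('a) - \<alpha>) * F y = W (x - y) * F y * norm (x - y) powr (\<alpha> - DIM('a))"
      using powr_minus_divide[of "norm (x - y)" "DIM('a) - \<alpha>"] by simp
    ultimately show ?thesis
      using W_nonneg F by (subst ennreal_mult[symmetric]) (auto intro!: ennreal_leI simp: mult_ac)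
  qed
  have term_le: "?near k + ?far k \<le> (\<Sum>k. ?near k + ?far k)" for k
    using sum_le_suminf[of "\<lambda>k. ?near k + ?far k" "{k}"] by auto
  from z show ?thesis
  proof (cases rule: dyadic_scale_exists)
    case (1 k)
    then have "2 powr (- real k - 1) * \<delta> \<le> norm (x - y)" "norm (x - y) < 2 powr (- real k) * \<delta>"
      using \<delta> by (simp_all add: field_simps)
    then have "ennreal (W (x - y) / norm (x - y) powr (DIM('a) - \<alpha>) * F y) \<le> ?near k"
      using kernel[of "2 powr (- real k - 1) * \<delta>"] \<delta> by (simp add: dist_norm)
    then show ?thesis
      using term_le[of k] by (meson add_increasing2 order_trans zero_le)
  next
    case (2 k)
    then have "2 powr real k * \<delta> \<le> norm (x - y)" "norm (x - y) < 2 powr (real k + 1) * \<delta>"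
      using \<delta> by (simp_all add: field_simps)
    then have "ennreal (W (x - y) / norm (x - y) powr (DIM('a) - \<alpha>) * F y) \<le> ?far k"
      using kernel[of "2 powr real k * \<delta>"] \<delta> by (simp add: dist_norm)
    then show ?thesis
      using term_le[of k] by (meson add_increasing order_trans zero_le)
  qed
\<comment> \<open>At \<open>x = y\<close> the left side is 0: \<open>0 powr a = 0\<close>, and
  division by 0 gives 0.\<close>
qed simp

text \<open>Hedberg's estimate: split at the radius \<open>\<delta>\<close> which balances the bound by \<open>\<mu>\<close> on small balls
  against the Morrey bound on large balls.\<close>

lemma potential_pointwise:
  assumes F: "morrey_unit F" and \<mu>: "0 < \<mu>"
    and small: "\<And>r. 0 < r \<Longrightarrow> (\<integral>\<^sup>+y\<in>ball x r. ennreal (F y powr u) \<partial>lborel) \<le> ennreal (\<mu> * r powr DIM('a))"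
  shows "potential F x \<le> ennreal (Cp * \<mu> powr \<theta>)"
proof -
  note [measurable] = morrey_unitD(1)[OF F]
  define d where "d = real DIM('a)"
  \<comment> \<open>The solution of \<open>\<mu> powr (1 / u) * \<delta> powr \<alpha> = \<delta>
    powr (\<alpha> - \<gamma>)\<close>.\<close>
  define \<delta> where "\<delta> = \<mu> powr (- 1 / (u * \<gamma>))"
  define w where "w = (vol powr (1 - u / p)) powr (1 / u)"
  have \<delta>: "0 < \<delta>" using \<mu> by (simp add: \<delta>_def)
  have g0: "0 < \<gamma>" using gamma alpha by simp
  define a where "a k = (2 powr (- real k - 1) * \<delta>) powr (\<alpha> - d)" for k :: nat
  define b where "b k = (2 powr real k * \<delta>) powr (\<alpha> - d)" for k :: nat
  define I where "I r = (\<integral>\<^sup>+y\<in>ball x r. ennreal (W (x - y) * F y) \<partial>lborel)" for r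
  have [measurable]: "ball x r \<in> sets borel" for r by simp
  have near: "I r \<le> ennreal (A * \<mu> powr (1 / u) * r powr d)" if "0 < r" for r
  proof -
    have "I r \<le> ennreal (A * r powr (DIM('a) - DIM('a) / u) * (\<mu> * r powr DIM('a)) powr (1 / u))"
      unfolding I_def using that \<mu> by (intro local_bound small morrey_unitD[OF F]) auto
    also have "r powr (DIM('a) - DIM('a) / u) * (\<mu> * r powr DIM('a)) powr (1 / u) = \<mu> powr (1 / u) * r powr d"
      using \<mu> that by (simp add: powr_mult powr_powr d_def mult.left_commute flip: powr_add)
    then have "A * r powr (DIM('a) - DIM('a) / u) * (\<mu> * r powr DIM('a)) powr (1 / u) = A * \<mu> powr (1 / u) * r powr d"
      by (metis mult.assoc)
    finally show ?thesis .
  qed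
  have far: "I r \<le> ennreal (A * w * r powr (d - \<gamma>))" if "0 < r" for r
  proof -
    have "I r \<le> ennreal (A * r powr (DIM('a) - DIM('a) / u) * (vol powr (1 - u / p) * r powr (DIM('a) - \<gamma> * u)) powr (1 / u))"
      unfolding I_def using that \<mu> by (intro local_bound morrey_unit_powr_u morrey_unitD[OF F] F) auto
    also have "A * r powr (DIM('a) - DIM('a) / u) * (vol powr (1 - u / p) * r powr (DIM('a) - \<gamma> * u)) powr (1 / u)
        = A * w * r powr (DIM('a) - DIM('a) / u + (DIM('a) - \<gamma> * u) * (1 / u))"
      using that by (simp only: powr_mult powr_ge_zero powr_powr w_def powr_add mult_ac)
    also have "DIM('a) - DIM('a) / u + (DIM('a) - \<gamma> * u) * (1 / u) = d - \<gamma>"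
      using pos by (simp add: d_def field_simps)
    finally show ?thesis .
  qed
  \<comment> \<open>Both contributions scale with the exponent
    \<open>(1 - \<alpha> / \<gamma>) / u\<close>, and the relation between \<open>p\<close> and
    \<open>q\<close> identifies it with \<open>\<theta>\<close>.\<close>
  have exp1: "\<mu> powr (1 / u) * \<delta> powr \<alpha> = \<mu> powr \<theta>" and exp2: "\<delta> powr (\<alpha> - \<gamma>) = \<mu> powr \<theta>"
  proof -
    have "1 / u + (- 1 / (u * \<gamma>)) * \<alpha> = (1 - \<alpha> / \<gamma>) / u" "(- 1 / (u * \<gamma>)) * (\<alpha> - \<gamma>) = (1 - \<alpha> / \<gamma>) / u"
      using pos g0 by (simp_all add: field_simps)
    moreover have "(1 - \<alpha> / \<gamma>) / u = \<theta>"
      by (simp add: gamma \<theta>_def)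
    ultimately show "\<mu> powr (1 / u) * \<delta> powr \<alpha> = \<mu> powr \<theta>" "\<delta> powr (\<alpha> - \<gamma>) = \<mu> powr \<theta>"
      unfolding \<delta>_def by (simp_all only: powr_powr powr_add[symmetric])
  qed
  have a_eq: "a k * (A * \<mu> powr (1 / u) * (2 powr (- real k) * \<delta>) powr d)
      = A * \<mu> powr \<theta> * 2 powr (d - \<alpha>) * (2 powr (- \<alpha>)) ^ k" for k
  proof -
    have "a k * (2 powr (- real k) * \<delta>) powr d = 2 powr ((- real k - 1) * (\<alpha> - d) + (- real k) * d) * \<delta> powr ((\<alpha> - d) + d)"
      using \<delta> by (simp only: a_def powr_mult powr_powr powr_add powr_ge_zero less_imp_le mult_ac)
    also have "(- real k - 1) * (\<alpha> - d) + (- real k) * d = (d - \<alpha>) + (- \<alpha>) * real k"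
      by (simp add: algebra_simps)
    also have "2 powr ((d - \<alpha>) + (- \<alpha>) * real k) = 2 powr (d - \<alpha>) * (2 powr (- \<alpha>)) ^ k"
      by (simp only: powr_add powr_powr[symmetric]) (simp add: powr_realpow)
    finally have eq: "a k * (2 powr (- real k) * \<delta>) powr d = 2 powr (d - \<alpha>) * (2 powr (- \<alpha>)) ^ k * \<delta> powr \<alpha>"
      by simp
    have "a k * (A * \<mu> powr (1 / u) * (2 powr (- real k) * \<delta>) powr d)
      = A * \<mu> powr (1 / u) * (a k * (2 powr (- real k) * \<delta>) powr d)"
      by (simp only: mult_ac)
    also have "\<dots> = A * (\<mu> powr (1 / u) * \<delta> powr \<alpha>) * 2 powr (d - \<alpha>) * (2 powr (- \<alpha>)) ^ k"
      unfolding eq by (simp only: mult_ac)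
    finally show ?thesis
      by (simp only: exp1)
  qed
  have b_eq: "b k * (A * w * (2 powr (real k + 1) * \<delta>) powr (d - \<gamma>))
      = A * \<mu> powr \<theta> * w * 2 powr (d - \<gamma>) * (2 powr (\<alpha> - \<gamma>)) ^ k" for k
  proof -
    have "b k * (2 powr (real k + 1) * \<delta>) powr (d - \<gamma>) = 2 powr (real k * (\<alpha> - d) + (real k + 1) * (d - \<gamma>)) * \<delta> powr ((\<alpha> - d) + (d - \<gamma>))"
      unfolding powr_add[of 2 "real k * (\<alpha> - d)"] powr_add[of \<delta>]
      using \<delta> by (simp only: b_def powr_mult powr_powr powr_ge_zero less_imp_le mult_ac)
    also have "real k * (\<alpha> - d) + (real k + 1) * (d - \<gamma>) = (d - \<gamma>) + (\<alpha> - \<gamma>) * real k"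
      by (simp add: algebra_simps)
    also have "2 powr ((d - \<gamma>) + (\<alpha> - \<gamma>) * real k) = 2 powr (d - \<gamma>) * (2 powr (\<alpha> - \<gamma>)) ^ k"
      by (simp only: powr_add powr_powr[symmetric]) (simp add: powr_realpow)
    finally have eq: "b k * (2 powr (real k + 1) * \<delta>) powr (d - \<gamma>) = 2 powr (d - \<gamma>) * (2 powr (\<alpha> - \<gamma>)) ^ k * \<delta> powr (\<alpha> - \<gamma>)"
      by simp
    have "b k * (A * w * (2 powr (real k + 1) * \<delta>) powr (d - \<gamma>))
      = A * w * (b k * (2 powr (real k + 1) * \<delta>) powr (d - \<gamma>))"
      by (simp only: mult_ac)
    also have "\<dots> = A * \<delta> powr (\<alpha> - \<gamma>) * w * 2 powr (d - \<gamma>) * (2 powr (\<alpha> - \<gamma>)) ^ k"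
      unfolding eq by (simp only: mult_ac)
    finally show ?thesis
      by (simp only: exp2)
  qed
  define ra rb where "ra = 2 powr (- \<alpha>)" and "rb = 2 powr (\<alpha> - \<gamma>)"
  \<comment> \<open>The ratios are below 1 because \<open>0 < \<alpha>\<close> and
    \<open>\<alpha> < \<gamma>\<close> respectively.\<close>
  have geo: "(\<lambda>k. ra ^ k) sums (1 / (1 - ra))" "(\<lambda>k. rb ^ k) sums (1 / (1 - rb))"
    using alpha gamma by (auto intro!: geometric_sums simp: ra_def rb_def powr_less_one)
  have "potential F x \<le> (\<integral>\<^sup>+y. (\<Sum>k. ennreal (a k) * (ennreal (W (x - y) * F y) * indicator (ball x (2 powr (- real k) * \<delta>)) y)
          + ennreal (b k) * (ennreal (W (x - y) * F y) * indicator (ball x (2 powr (real k + 1) * \<delta>)) y)) \<partial>lborel)"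
    unfolding potential_def a_def b_def d_def using \<delta> morrey_unitD(2)[OF F]
    by (intro nn_integral_mono kernel_dyadic_bound) auto
  also have "\<dots> = (\<Sum>k. (\<integral>\<^sup>+y. ennreal (a k) * (ennreal (W (x - y) * F y) * indicator (ball x (2 powr (- real k) * \<delta>)) y)
          + ennreal (b k) * (ennreal (W (x - y) * F y) * indicator (ball x (2 powr (real k + 1) * \<delta>)) y) \<partial>lborel))"
    by (rule nn_integral_suminf) measurable
  also have "\<dots> = (\<Sum>k. ennreal (a k) * I (2 powr (- real k) * \<delta>) + ennreal (b k) * I (2 powr (real k + 1) * \<delta>))"
    unfolding I_def by (subst nn_integral_add; (subst nn_integral_cmult)?; (subst nn_integral_cmult)?; measurable)
  also have "\<dots> \<le> (\<Sum>k. ennreal (A * \<mu> powr \<theta> * 2 powr (d - \<alpha>) * ra ^ k + A * \<mu> powr \<theta> * w * 2 powr (d - \<gamma>) * rb ^ k))"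
  proof (rule suminf_le)
    fix k
    have "ennreal (a k) * I (2 powr (- real k) * \<delta>) \<le> ennreal (a k) * ennreal (A * \<mu> powr (1 / u) * (2 powr (- real k) * \<delta>) powr d)"
      using \<delta> by (intro mult_left_mono near) auto
    also have "\<dots> = ennreal (A * \<mu> powr \<theta> * 2 powr (d - \<alpha>) * ra ^ k)"
      unfolding ra_def a_eq[symmetric] using A_pos by (subst ennreal_mult) (auto simp: a_def)
    finally have 1: "ennreal (a k) * I (2 powr (- real k) * \<delta>) \<le> ennreal (A * \<mu> powr \<theta> * 2 powr (d - \<alpha>) * ra ^ k)" .
    have "ennreal (b k) * I (2 powr (real k + 1) * \<delta>) \<le> ennreal (b k) * ennreal (A * w * (2 powr (real k + 1) * \<delta>) powr (d - \<gamma>))"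
      using \<delta> by (intro mult_left_mono far) auto
    also have "\<dots> = ennreal (A * \<mu> powr \<theta> * w * 2 powr (d - \<gamma>) * rb ^ k)"
      unfolding rb_def b_eq[symmetric] using A_pos by (subst ennreal_mult) (auto simp: b_def w_def)
    finally have 2: "ennreal (b k) * I (2 powr (real k + 1) * \<delta>) \<le> ennreal (A * \<mu> powr \<theta> * w * 2 powr (d - \<gamma>) * rb ^ k)" .
    show "ennreal (a k) * I (2 powr (- real k) * \<delta>) + ennreal (b k) * I (2 powr (real k + 1) * \<delta>)
        \<le> ennreal (A * \<mu> powr \<theta> * 2 powr (d - \<alpha>) * ra ^ k + A * \<mu> powr \<theta> * w * 2 powr (d - \<gamma>) * rb ^ k)"
      using add_mono[OF 1 2] A_pos by (subst ennreal_plus) (auto simp: ra_def rb_def w_def)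
  qed auto
  also have "\<dots> = ennreal (Cp * \<mu> powr \<theta>)"
  proof (rule suminf_ennreal_eq)
    have "(\<lambda>k. A * \<mu> powr \<theta> * 2 powr (d - \<alpha>) * ra ^ k + A * \<mu> powr \<theta> * w * 2 powr (d - \<gamma>) * rb ^ k) sums
        (A * \<mu> powr \<theta> * 2 powr (d - \<alpha>) * (1 / (1 - ra)) + A * \<mu> powr \<theta> * w * 2 powr (d - \<gamma>) * (1 / (1 - rb)))"
      by (intro sums_add sums_mult geo)
    also have "A * \<mu> powr \<theta> * 2 powr (d - \<alpha>) * (1 / (1 - ra)) + A * \<mu> powr \<theta> * w * 2 powr (d - \<gamma>) * (1 / (1 - rb)) = Cp * \<mu> powr \<theta>"
      by (simp add: Cp_def ra_def rb_def w_def d_def algebra_simps)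
    finally show "(\<lambda>k. A * \<mu> powr \<theta> * 2 powr (d - \<alpha>) * ra ^ k + A * \<mu> powr \<theta> * w * 2 powr (d - \<gamma>) * rb ^ k) sums (Cp * \<mu> powr \<theta>)" .
  qed (use A_pos in \<open>auto simp: ra_def rb_def w_def\<close>)
  finally show ?thesis .
qed

lemma Cp_pos: "0 < Cp"
proof -
  have "(2::real) powr (- \<alpha>) < 1" "(2::real) powr (\<alpha> - \<gamma>) < 1"
    using alpha gamma by (simp_all add: powr_less_one)
  then show ?thesis
    using A_pos vol_pos by (auto simp: Cp_def intro!: add_pos_pos divide_pos_pos mult_pos_pos)
qed

lemma theta_pos: "0 < \<theta>"
  using pos by (simp add: \<theta>_def)

section \<open>Level sets of the potential inside a ball\<close>

text \<open>An upper bound, given by the Morrey condition, for the mass of \<open>F powr u\<close>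
  divided by \<open>r powr n\<close> on every ball of radius \<open>r \<ge> R\<close>.\<close>

definition threshold :: "real \<Rightarrow> real" where
  "threshold R = vol powr (1 - u / p) * R powr (- (\<gamma> * u))"

lemma threshold_pos: "0 < R \<Longrightarrow> 0 < threshold R"
  using vol_pos by (simp add: threshold_def)

text \<open>The contrapositive of Hedberg's estimate supplies a ball whose density exceeds
  \<open>\<mu>\<close>. Its radius must be below \<open>R\<close>, since on larger balls the density
  is at most \<open>threshold R\<close>.\<close>

lemma potential_large_imp_small_ball:
  assumes F: "morrey_unit F" and R: "0 < R" and \<mu>: "threshold R < \<mu>"
    and large: "ennreal (Cp * \<mu> powr \<theta>) < potential F x"
  shows "\<exists>r>0. r < R \<and> ennreal (\<mu> * r powr DIM('a)) \<le> (\<integral>\<^sup>+y\<in>ball x r. ennreal (F y powr u) \<partial>lborel)"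
proof -
  have mu_pos: "0 < \<mu>"
    using threshold_pos[OF R] \<mu> by simp
  have "\<exists>r>0. ennreal (\<mu> * r powr DIM('a)) < (\<integral>\<^sup>+y\<in>ball x r. ennreal (F y powr u) \<partial>lborel)"
    using potential_pointwise[OF F mu_pos, of x] large by (meson leD not_le_imp_less)
  then obtain r where r: "0 < r" "ennreal (\<mu> * r powr DIM('a)) < (\<integral>\<^sup>+y\<in>ball x r. ennreal (F y powr u) \<partial>lborel)"
    by blast
  have "r < R"
  proof (rule ccontr)
    assume "\<not> r < R"
    then have "R \<le> r" by simp
    have "ennreal (\<mu> * r powr DIM('a)) \<le> ennreal (vol powr (1 - u / p) * r powr (DIM('a) - \<gamma> * u))"
      using r(2) morrey_unit_powr_u[OF F r(1), of x] by (meson less_imp_le order_trans)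
    then have "\<mu> * r powr DIM('a) \<le> vol powr (1 - u / p) * r powr (- (\<gamma> * u)) * r powr DIM('a)"
      by (simp add: ennreal_le_iff powr_diff powr_minus divide_inverse mult_ac)
    then have "\<mu> \<le> vol powr (1 - u / p) * r powr (- (\<gamma> * u))"
      using r(1) by simp
    also have "\<dots> \<le> threshold R"
      unfolding threshold_def using \<open>R \<le> r\<close> R gamma alpha pos vol_pos
      by (intro mult_left_mono powr_mono2') auto
    finally show False
      using \<mu> by simp
  qed
  then show ?thesis
    using r by (auto intro: less_imp_le)
qed

lemma morrey_unit_finite_on_balls:
  assumes F: "morrey_unit F"
  obtains X where "0 \<le> X" "(\<integral>\<^sup>+y\<in>ball c r. ennreal (F y powr u) \<partial>lborel) \<le> ennreal X"
proof (cases "0 < r")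
  case True
  then show ?thesis
    using morrey_unit_powr_u[OF F True, of c] by (intro that) auto
next
  case False
  then show ?thesis
    by (intro that[of 0]) (auto simp: ball_empty)
qed

text \<open>Where the potential is infinite it exceeds every level, so the covering bound applies
  with every large \<open>\<mu>\<close> and tends to 0. This argument needs no distinction between
  \<open>u = p\<close> and \<open>u < p\<close>.\<close>

lemma potential_finite_AE:
  assumes F: "morrey_unit F"
  shows "AE x in lborel. potential F x < \<infinity>"
proof -
  note [measurable] = morrey_unitD(1)[OF F]
  have [measurable]: "ball a s \<in> sets borel" for a :: 'a and s by simp
  have null: "emeasure lborel {x \<in> ball 0 R. potential F x = \<infinity>} = 0" if R: "0 < R" for R
  proof -
    let ?S = "{x \<in> ball 0 R. potential F x = \<infinity>}"
    obtain X where X: "0 \<le> X" "(\<integral>\<^sup>+y\<in>ball 0 (2 * R). ennreal (F y powr u) \<partial>lborel) \<le> ennreal X"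
      using morrey_unit_finite_on_balls[OF F] by blast
    have bound: "emeasure lborel ?S \<le> ennreal (5 ^ DIM('a) * vol * X / \<mu>)" if \<mu>: "threshold R < \<mu>" for \<mu>
    proof -
      have mu_pos: "0 < \<mu>"
        using threshold_pos[OF R] \<mu> by simp
      have "emeasure lborel ?S \<le> ennreal (5 ^ DIM('a) * vol / \<mu>) * (\<integral>\<^sup>+y\<in>ball 0 (2 * R). ennreal (F y powr u) \<partial>lborel)"
        unfolding vol_def using mu_pos potential_large_imp_small_ball[OF F R \<mu>]
        by (intro maximal_weak_bound) auto
      also have "\<dots> \<le> ennreal (5 ^ DIM('a) * vol / \<mu>) * ennreal X"
        by (intro mult_left_mono X) auto
      also have "\<dots> = ennreal (5 ^ DIM('a) * vol * X / \<mu>)"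
        using X vol_pos mu_pos by (subst ennreal_mult[symmetric]) auto
      finally show ?thesis .
    qed
    have "((\<lambda>\<mu>. ennreal (5 ^ DIM('a) * vol * X / \<mu>)) \<longlongrightarrow> ennreal 0) at_top"
      by (intro tendsto_ennrealI tendsto_divide_0[OF tendsto_const] filterlim_at_top_imp_at_infinity filterlim_ident)
    moreover have "\<forall>\<^sub>F \<mu> in at_top. emeasure lborel ?S \<le> ennreal (5 ^ DIM('a) * vol * X / \<mu>)"
      using eventually_gt_at_top[of "threshold R"] by eventually_elim (rule bound)
    ultimately have "emeasure lborel ?S \<le> ennreal 0"
      by (rule tendsto_lowerbound) simp
    then show ?thesis by simp
  qed
  \<comment> \<open>Balls of radius \<open>k + 1\<close> exhaust the space, and this radius is
    positive even for \<open>k = 0\<close>, as \<open>null\<close> requires.\<close>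
  have "AE x in lborel. \<forall>k::nat. \<not> (x \<in> ball 0 (real k + 1) \<and> potential F x = \<infinity>)"
    unfolding AE_all_countable
  proof
    fix k :: nat
    show "AE x in lborel. \<not> (x \<in> ball 0 (real k + 1) \<and> potential F x = \<infinity>)"
      using null[of "real k + 1"] by (subst AE_iff_measurable[OF _ refl]) auto
  qed
  then show ?thesis
  proof eventually_elim
    case (elim x)
    obtain k :: nat where "norm x < real k"
      using reals_Archimedean2 by blast
    then have "x \<in> ball 0 (real k + 1)"
      by simp
    with elim show ?case
      by (auto simp: less_top)
  qed
qed

text \<open>Translates a level \<open>t\<close> of the potential into the density
  \<open>\<mu>\<close> whose Hedberg bound is \<open>t\<close>.\<close>

lemma level_inverse:
  assumes "0 < t"
  shows "Cp * ((t / Cp) powr (1 / \<theta>)) powr \<theta> = t"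
  using assms Cp_pos theta_pos by (simp add: powr_powr)

text \<open>For \<open>u = p\<close> the density belonging to the level \<open>t\<close> is
  \<open>(t / Cp) powr q\<close>, so \<open>t powr q\<close> cancels the factor
  \<open>1 / \<mu>\<close> of the covering bound. Below the threshold the volume of the ball
  suffices, because \<open>R powr (- (\<gamma> * p))\<close> times \<open>R powr n\<close> is
  \<open>R powr (n * \<kappa>)\<close>.\<close>

lemma weak_estimate:
  assumes F: "morrey_unit F" and [measurable]: "H \<in> borel_measurable borel"
    and H: "\<And>x. ennreal (H x) \<le> potential F x"
    and up: "u = p" and R: "0 < R" and t: "0 < t"
  shows "ennreal (t powr q) * emeasure lborel {x \<in> ball c R. t < H x}
    \<le> ennreal (Cp powr q * vol * (1 + 5 ^ DIM('a) * 2 powr (DIM('a) * \<kappa>)) * R powr (DIM('a) * \<kappa>))"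
proof -
  note [measurable] = morrey_unitD(1)[OF F]
  have [measurable]: "ball a s \<in> sets borel" for a :: 'a and s by simp
  let ?S = "{x \<in> ball c R. t < H x}"
  define \<mu> where "\<mu> = (t / Cp) powr q"
  have theta: "1 / \<theta> = q"
    unfolding \<theta>_def using up pos by simp
  have mu: "0 < \<mu>" "t powr q = Cp powr q * \<mu>"
    using t Cp_pos by (simp_all add: \<mu>_def powr_divide)
  have split: "Cp powr q * vol * (1 + 5 ^ DIM('a) * 2 powr (DIM('a) * \<kappa>)) * R powr (DIM('a) * \<kappa>)
     = Cp powr q * vol * R powr (DIM('a) * \<kappa>) + Cp powr q * (5 ^ DIM('a) * vol * (2 * R) powr (DIM('a) * \<kappa>))"
    using R by (simp add: powr_mult algebra_simps)
  show ?thesis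
  proof (cases "threshold R < \<mu>")
    case True
    have "emeasure lborel ?S \<le> ennreal (5 ^ DIM('a) * vol / \<mu>) * (\<integral>\<^sup>+y\<in>ball c (2 * R). ennreal (F y powr u) \<partial>lborel)"
      unfolding vol_def
    proof (rule maximal_weak_bound)
      fix x assume "x \<in> ?S"
      then have "ennreal t < potential F x"
        using H[of x] t less_le_trans[of "ennreal t" "ennreal (H x)"] by (simp add: ennreal_less_iff)
      then have "ennreal (Cp * \<mu> powr \<theta>) < potential F x"
        using level_inverse[OF t] by (simp add: theta \<mu>_def)
      then show "\<exists>r>0. r < R \<and> ennreal (\<mu> * r powr DIM('a)) \<le> (\<integral>\<^sup>+y\<in>ball x r. ennreal (F y powr u) \<partial>lborel)"
        by (rule potential_large_imp_small_ball[OF F R True])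
    qed (use mu in auto)
    also have "\<dots> \<le> ennreal (5 ^ DIM('a) * vol / \<mu>) * ennreal ((2 * R) powr (DIM('a) * \<kappa>))"
      using R unfolding up by (intro mult_left_mono morrey_unitD[OF F]) auto
    finally have "ennreal (t powr q) * emeasure lborel ?S
        \<le> ennreal (t powr q) * (ennreal (5 ^ DIM('a) * vol / \<mu>) * ennreal ((2 * R) powr (DIM('a) * \<kappa>)))"
      by (intro mult_left_mono) auto
    also have "\<dots> = ennreal (t powr q * (5 ^ DIM('a) * vol / \<mu> * (2 * R) powr (DIM('a) * \<kappa>)))"
      using mu(1) vol_pos by (simp flip: ennreal_mult)
    also have "t powr q * (5 ^ DIM('a) * vol / \<mu> * (2 * R) powr (DIM('a) * \<kappa>)) = Cp powr q * (5 ^ DIM('a) * vol * (2 * R) powr (DIM('a) * \<kappa>))"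
      using mu by simp
    finally show ?thesis
      unfolding split using vol_pos by (elim order_trans) (auto intro!: ennreal_leI)
  next
    case False
    then have le: "\<mu> \<le> R powr (- (\<gamma> * p))"
    proof -
      have "threshold R = R powr (- (\<gamma> * p))"
        unfolding threshold_def using vol_pos pos up by simp
      then show ?thesis using False by simp
    qed
    have "emeasure lborel ?S \<le> emeasure lborel (ball c R)"
      by (intro emeasure_mono) auto
    then have "ennreal (t powr q) * emeasure lborel ?S \<le> ennreal (t powr q) * ennreal (vol * R powr DIM('a))"
      using R by (intro mult_left_mono) (auto simp: emeasure_ball vol_def powr_realpow)
    also have "\<dots> = ennreal (Cp powr q * \<mu> * (vol * R powr DIM('a)))"
      using mu vol_pos by (simp add: ennreal_mult)
    also have "\<dots> \<le> ennreal (Cp powr q * R powr (- (\<gamma> * p)) * (vol * R powr DIM('a)))"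
      using le vol_pos by (intro ennreal_leI mult_right_mono mult_left_mono) auto
    also have "Cp powr q * R powr (- (\<gamma> * p)) * (vol * R powr DIM('a)) = Cp powr q * vol * R powr (DIM('a) * \<kappa>)"
    proof -
      have "R powr (- (\<gamma> * p)) * R powr DIM('a) = R powr (DIM('a) * \<kappa>)"
        unfolding gamma(3) powr_add[symmetric] by (simp add: algebra_simps)
      then show ?thesis by (simp add: mult_ac)
    qed
    finally show ?thesis
      unfolding split using vol_pos by (elim order_trans) (auto intro!: ennreal_leI)
  qed
qed

text \<open>The first summand comes from levels below the threshold level, the second from
  integrating the truncated covering bound over the higher levels; the last factor is due to the
  doubled ball.\<close>

definition Cs :: real where
  "Cs = Cp powr q * (2 * vol powr (1 - u / p)) powr (p / u) * vol
    + 2 * 5 ^ DIM('a) * vol * Cp powr (1 / \<theta>) * q / (q - 1 / \<theta>) * (Cp * (2 * vol) powr \<theta>) powr (q - 1 / \<theta>) * 2 powr (DIM('a) * \<kappa>)"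

lemma Cs_pos:
  assumes "u < p"
  shows "0 < Cs"
proof -
  have "0 < q - 1 / \<theta>"
    using assms pos by (simp add: \<theta>_def field_simps)
  then show ?thesis
    unfolding Cs_def using Cp_pos vol_pos pos
    by (intro add_pos_pos mult_pos_pos divide_pos_pos) auto
qed

text \<open>With \<open>g = F powr u\<close> the exponent \<open>q * \<theta> = p / u\<close>
  exceeds 1, so the levels can be integrated, and \<open>g powr (q * \<theta>)\<close> is
  \<open>F powr p\<close>, which the Morrey condition controls on the doubled ball.\<close>

lemma strong_estimate:
  assumes F: "morrey_unit F" and [measurable]: "H \<in> borel_measurable borel"
    and H: "\<And>x. ennreal (H x) \<le> potential F x" "\<And>x. 0 \<le> H x"
    and up: "u < p" and R: "0 < R"
  shows "(\<integral>\<^sup>+x\<in>ball c R. ennreal (H x powr q) \<partial>lborel) \<le> ennreal (Cs * R powr (DIM('a) * \<kappa>))"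
proof -
  note [measurable] = morrey_unitD(1)[OF F]
  have [measurable]: "ball a s \<in> sets borel" for a :: 'a and s by simp
  define g where "g y = F y powr u" for y
  have [measurable]: "g \<in> borel_measurable borel"
    unfolding g_def by measurable
  \<comment> \<open>\<open>t0\<close> is the level of density \<open>2 * threshold R\<close>; the
    factor 2 secures the strict inequality \<open>threshold R < \<mu>\<close> for every level from
    \<open>t0\<close> on. \<open>C\<close> and \<open>K\<close> rewrite the truncated covering bound
    at \<open>\<mu> = (t / Cp) powr (1 / \<theta>)\<close> in terms of \<open>t\<close>.\<close>
  define t0 where "t0 = Cp * (2 * threshold R) powr \<theta>"
  define C where "C = Cp * (2 * vol) powr \<theta>"
  define K where "K = 2 * 5 ^ DIM('a) * vol * Cp powr (1 / \<theta>)"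
  have qt: "q * \<theta> = p / u"
    using pos by (simp add: \<theta>_def)
  have qt': "0 < q - 1 / \<theta>"
    using up pos by (simp add: \<theta>_def field_simps)
  have Kpos: "0 < K" and Cpos: "0 < C"
    using vol_pos Cp_pos by (simp_all add: K_def C_def)
  have Cs_eq: "Cs = Cp powr q * (2 * vol powr (1 - u / p)) powr (p / u) * vol
      + K * q / (q - 1 / \<theta>) * C powr (q - 1 / \<theta>) * 2 powr (DIM('a) * \<kappa>)"
    by (simp add: Cs_def K_def C_def)
  have "(\<integral>\<^sup>+x\<in>ball c R. ennreal (H x powr q) \<partial>lborel) \<le> ennreal (t0 powr q) * emeasure lborel (ball c R)
    + ennreal (K * q / (q - 1 / \<theta>) * C powr (q - 1 / \<theta>)) * (\<integral>\<^sup>+y\<in>ball c (2 * R). ennreal (g y powr (q * \<theta>)) \<partial>lborel)"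
  proof (rule strong_bound_from_truncated_weak_bound)
    fix t :: real assume t: "0 < t" "t0 \<le> t"
    define \<mu> where "\<mu> = (t / Cp) powr (1 / \<theta>)"
    have mu: "0 < \<mu>" using t Cp_pos by (simp add: \<mu>_def)
    have "2 * threshold R = ((2 * threshold R) powr \<theta>) powr (1 / \<theta>)"
      using threshold_pos[OF R] theta_pos by (simp add: powr_powr)
    also have "\<dots> \<le> \<mu>"
      unfolding \<mu>_def using t Cp_pos theta_pos by (intro powr_mono2) (auto simp: t0_def field_simps)
    finally have thr: "threshold R < \<mu>"
      using threshold_pos[OF R] by simp
    have "emeasure lborel {x \<in> ball c R. t < H x} \<le> ennreal (2 * 5 ^ DIM('a) * unit_ball_vol DIM('a) / \<mu>)
      * (\<integral>\<^sup>+y\<in>ball c (2 * R). (if \<mu> < 2 * unit_ball_vol DIM('a) * g y then ennreal (g y) else 0) \<partial>lborel)"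
    proof (rule maximal_weak_bound_truncated)
      fix x assume "x \<in> {x \<in> ball c R. t < H x}"
      then have "ennreal t < potential F x"
        using H(1)[of x] t less_le_trans[of "ennreal t" "ennreal (H x)"] by (simp add: ennreal_less_iff)
      then have "ennreal (Cp * \<mu> powr \<theta>) < potential F x"
        using level_inverse[OF t(1)] by (simp add: \<mu>_def)
      then show "\<exists>r>0. r < R \<and> ennreal (\<mu> * r powr DIM('a)) \<le> (\<integral>\<^sup>+y\<in>ball x r. ennreal (g y) \<partial>lborel)"
        unfolding g_def by (rule potential_large_imp_small_ball[OF F R thr])
    qed (use mu in \<open>auto simp: g_def\<close>)
    also have "2 * 5 ^ DIM('a) * unit_ball_vol DIM('a) / \<mu> = K * t powr (- 1 / \<theta>)"
      using t Cp_pos by (simp add: K_def \<mu>_def vol_def powr_divide powr_minus field_simps)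
    also have "(\<integral>\<^sup>+y\<in>ball c (2 * R). (if \<mu> < 2 * unit_ball_vol DIM('a) * g y then ennreal (g y) else 0) \<partial>lborel)
        \<le> (\<integral>\<^sup>+y\<in>ball c (2 * R). (if t < C * g y powr \<theta> then ennreal (g y) else 0) \<partial>lborel)"
    proof -
      have "t < C * g y powr \<theta>" if "\<mu> < 2 * unit_ball_vol DIM('a) * g y" for y
      proof -
        have "t = Cp * \<mu> powr \<theta>"
          using level_inverse[OF t(1)] by (simp add: \<mu>_def)
        also have "\<dots> < Cp * (2 * vol * g y) powr \<theta>"
          using that mu Cp_pos theta_pos by (intro mult_strict_left_mono powr_less_mono2) (auto simp: vol_def)
        also have "\<dots> = C * g y powr \<theta>"
          using vol_pos by (simp add: C_def powr_mult g_def)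
        finally show ?thesis .
      qed
      then show ?thesis
        by (intro nn_integral_mono) (auto simp: indicator_def)
    qed
    finally show "emeasure lborel {x \<in> ball c R. t < H x}
      \<le> ennreal (K * t powr (- 1 / \<theta>)) * (\<integral>\<^sup>+y\<in>ball c (2 * R). (if t < C * g y powr \<theta> then ennreal (g y) else 0) \<partial>lborel)"
      by (simp add: mult_left_mono)
  qed (use H pos theta_pos Kpos Cpos Cp_pos up qt in \<open>auto simp: g_def t0_def\<close>)
  also have "(\<integral>\<^sup>+y\<in>ball c (2 * R). ennreal (g y powr (q * \<theta>)) \<partial>lborel) = (\<integral>\<^sup>+y\<in>ball c (2 * R). ennreal (F y powr p) \<partial>lborel)"
    using pos by (simp add: g_def powr_powr qt)
  also have "ennreal (t0 powr q) * emeasure lborel (ball c R)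
    + ennreal (K * q / (q - 1 / \<theta>) * C powr (q - 1 / \<theta>)) * (\<integral>\<^sup>+y\<in>ball c (2 * R). ennreal (F y powr p) \<partial>lborel)
    \<le> ennreal (t0 powr q) * ennreal (vol * R powr DIM('a))
    + ennreal (K * q / (q - 1 / \<theta>) * C powr (q - 1 / \<theta>)) * ennreal ((2 * R) powr (DIM('a) * \<kappa>))"
    using R by (intro add_mono mult_left_mono morrey_unitD[OF F]) (auto simp: emeasure_ball vol_def powr_realpow)
  also have "\<dots> = ennreal (t0 powr q * (vol * R powr DIM('a)) + K * q / (q - 1 / \<theta>) * C powr (q - 1 / \<theta>) * (2 * R) powr (DIM('a) * \<kappa>))"
  proof -
    have "0 \<le> K * q / (q - 1 / \<theta>) * C powr (q - 1 / \<theta>)"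
      using Kpos qt' pos by auto
    then show ?thesis
      using vol_pos by (simp only: ennreal_mult[symmetric] ennreal_plus[symmetric] powr_ge_zero
          mult_nonneg_nonneg less_imp_le)
  qed
  also have "t0 powr q * (vol * R powr DIM('a)) + K * q / (q - 1 / \<theta>) * C powr (q - 1 / \<theta>) * (2 * R) powr (DIM('a) * \<kappa>)
      = Cs * R powr (DIM('a) * \<kappa>)"
  proof -
    have "t0 powr q = Cp powr q * (2 * threshold R) powr (p / u)"
      using Cp_pos threshold_pos[OF R] by (simp add: t0_def powr_mult powr_powr qt mult.commute)
    also have "(2 * threshold R) powr (p / u) = (2 * vol powr (1 - u / p)) powr (p / u) * R powr (- (\<gamma> * p))"
      using pos by (simp add: threshold_def powr_mult powr_powr)
    finally have "t0 powr q * (vol * R powr DIM('a)) = Cp powr q * (2 * vol powr (1 - u / p)) powr (p / u) * vol * (R powr (- (\<gamma> * p)) * R powr DIM('a))"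
      by (simp only: mult_ac)
    also have "R powr (- (\<gamma> * p)) * R powr DIM('a) = R powr (DIM('a) * \<kappa>)"
      unfolding gamma(3) powr_add[symmetric] by (simp add: algebra_simps)
    finally show ?thesis
      using R by (simp add: Cs_eq powr_mult algebra_simps)
  qed
  finally show "(\<integral>\<^sup>+x\<in>ball c R. ennreal (H x powr q) \<partial>lborel) \<le> ennreal (Cs * R powr (DIM('a) * \<kappa>))" .
qed

end

section \<open>Morrey norms as inequalities on balls\<close>

lemma ennpowr_leI:
  assumes "0 < a" "0 \<le> K" "x \<le> ennreal (K powr a)"
  shows "ennpowr x (1 / a) \<le> ennreal K"
proof (cases x)
  case (real r)
  then have "r \<le> K powr a"
    using assms by (simp add: ennreal_le_iff)
  then have "r powr (1 / a) \<le> (K powr a) powr (1 / a)"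
    using assms real by (intro powr_mono2) auto
  then show ?thesis
    using assms real by (auto simp: ennpowr_def powr_powr intro!: ennreal_leI)
qed (use assms in \<open>auto simp: top_unique\<close>)

lemma ennpowr_leD:
  assumes "0 < a" "0 \<le> K" "ennpowr x (1 / a) \<le> ennreal K"
  shows "x \<le> ennreal (K powr a)"
proof (cases x)
  case (real r)
  then have "r powr (1 / a) \<le> K"
    using assms by (simp add: ennpowr_def ennreal_le_iff)
  then have "(r powr (1 / a)) powr a \<le> K powr a"
    using assms by (intro powr_mono2) auto
  then show ?thesis
    using assms real by (auto simp: powr_powr intro!: ennreal_leI)
qed (use assms in \<open>auto simp: ennpowr_def top_unique\<close>)

lemma ennreal_divide_le_iff:
  fixes x :: ennreal
  assumes "0 < Y" "0 \<le> b"
  shows "x / ennreal Y \<le> ennreal b \<longleftrightarrow> x \<le> ennreal (b * Y)"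
proof (cases x)
  case (real r)
  then show ?thesis
    using assms by (simp add: divide_ennreal ennreal_le_iff pos_divide_le_eq)
qed (use assms in \<open>auto simp: ennreal_top_divide top_unique\<close>)

lemma measure_ball_powr:
  fixes c :: "'a::euclidean_space" and \<kappa> :: real
  assumes "0 < r"
  shows "measure lebesgue (ball c r) powr \<kappa> = unit_ball_vol DIM('a) powr \<kappa> * r powr (DIM('a) * \<kappa>)"
    and "0 < measure lebesgue (ball c r)"
proof -
  have *: "measure lebesgue (ball c r) = unit_ball_vol DIM('a) * r powr DIM('a)"
    using assms by (simp add: content_ball powr_realpow)
  show "measure lebesgue (ball c r) powr \<kappa> = unit_ball_vol DIM('a) powr \<kappa> * r powr (DIM('a) * \<kappa>)"
    using assms by (simp add: * powr_mult powr_powr)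
  show "0 < measure lebesgue (ball c r)"
    using assms by (simp add: *)
qed

text \<open>Both directions serve: one extracts ball estimates from the norm of \<open>f\<close>,
  the other proves the norm bound for the operator.\<close>

lemma morrey_norm_le_iff:
  fixes g :: "'a::euclidean_space \<Rightarrow> complex" and \<kappa> :: real
  assumes "0 < p" "0 \<le> K"
  shows "morrey_norm p \<kappa> g \<le> ennreal K \<longleftrightarrow> (\<forall>c r. 0 < r \<longrightarrow>
    (\<integral>\<^sup>+x\<in>ball c r. ennreal (norm (g x) powr p) \<partial>lborel)
      \<le> ennreal (K powr p * (unit_ball_vol DIM('a) powr \<kappa> * r powr (DIM('a) * \<kappa>))))"
proof -
  have "ennpowr ((\<integral>\<^sup>+x\<in>ball c r. ennreal (norm (g x) powr p) \<partial>lebesgue)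
              / ennreal (measure lebesgue (ball c r) powr \<kappa>)) (1 / p) \<le> ennreal K \<longleftrightarrow>
      (\<integral>\<^sup>+x\<in>ball c r. ennreal (norm (g x) powr p) \<partial>lborel)
      \<le> ennreal (K powr p * (unit_ball_vol DIM('a) powr \<kappa> * r powr (DIM('a) * \<kappa>)))"
    if "0 < r" for c :: 'a and r
  proof -
    have m: "0 < measure lebesgue (ball c r) powr \<kappa>"
      using measure_ball_powr(2)[OF that, of c] by simp
    have root: "ennpowr x (1 / p) \<le> ennreal K \<longleftrightarrow> x \<le> ennreal (K powr p)" for x
      using ennpowr_leI[OF assms] ennpowr_leD[OF assms] by blast
    show ?thesis
      unfolding measure_ball_powr(1)[OF that, of c, symmetric] nn_integral_completion root
      using m by (intro ennreal_divide_le_iff) auto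
  qed
  then show ?thesis
    by (auto simp: morrey_norm_def SUP_le_iff)
qed

lemma weak_morrey_norm_le:
  fixes g :: "'a::euclidean_space \<Rightarrow> complex" and \<kappa> :: real
  assumes q: "0 < q" "0 \<le> K" and [measurable]: "g \<in> borel_measurable borel"
    and bound: "\<And>c r t. 0 < r \<Longrightarrow> 0 < t \<Longrightarrow> ennreal (t powr q) * emeasure lborel {x \<in> ball c r. t < norm (g x)}
      \<le> ennreal (K powr q * (unit_ball_vol DIM('a) powr \<kappa> * r powr (DIM('a) * \<kappa>)))"
  shows "weak_morrey_norm q \<kappa> g \<le> ennreal K"
proof -
  have [measurable]: "ball a s \<in> sets borel" for a :: 'a and s by simp
  have "ennreal t * ennpowr (emeasure lebesgue {x \<in> ball c r. norm (g x) > t}) (1 / q)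
      \<le> ennreal (K * measure lebesgue (ball c r) powr (\<kappa> / q))" if r: "0 < r" and t: "0 < t" for c r t
  proof -
    let ?m = "measure lebesgue (ball c r)"
    let ?S = "{x \<in> ball c r. t < norm (g x)}"
    have m: "0 < ?m" using measure_ball_powr(2)[OF r] .
    have S: "?S \<in> sets borel" by measurable
    \<comment> \<open>Finiteness lets the bound pass to real numbers, where \<open>t powr q\<close>
      can be divided out.\<close>
    have fin: "emeasure lborel ?S \<noteq> \<infinity>"
    proof -
      have "emeasure lborel ?S \<le> emeasure lborel (ball c r)"
        by (intro emeasure_mono) auto
      then show ?thesis
        using emeasure_lborel_ball_finite[of c r] by (auto simp: top_unique)
    qed
    have "emeasure lebesgue ?S = emeasure lborel ?S"
      using S by simp
    also have "\<dots> \<le> ennreal ((K * ?m powr (\<kappa> / q) / t) powr q)"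
    proof -
      obtain e where e: "emeasure lborel ?S = ennreal e" "0 \<le> e"
        using fin by (cases "emeasure lborel ?S") auto
      have "ennreal (t powr q * e) \<le> ennreal (K powr q * ?m powr \<kappa>)"
        using bound[OF r t, of c] e by (simp only: measure_ball_powr(1)[OF r] ennreal_mult powr_ge_zero mult_nonneg_nonneg
            unit_ball_vol_nonneg)
      then have "t powr q * e \<le> K powr q * ?m powr \<kappa>"
        by (simp add: ennreal_le_iff)
      also have "K powr q * ?m powr \<kappa> = t powr q * (K * ?m powr (\<kappa> / q) / t) powr q"
        using q t m by (simp add: powr_mult powr_divide powr_powr)
      finally show ?thesis
        using e t by (auto intro!: ennreal_leI)
    qed
    finally have "ennpowr (emeasure lebesgue ?S) (1 / q) \<le> ennreal (K * ?m powr (\<kappa> / q) / t)"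
      using q t by (intro ennpowr_leI) auto
    then have "ennreal t * ennpowr (emeasure lebesgue ?S) (1 / q) \<le> ennreal t * ennreal (K * ?m powr (\<kappa> / q) / t)"
      by (intro mult_left_mono) auto
    then show ?thesis
      using q t by (simp flip: ennreal_mult)
  qed
  then have sup: "(SUP t\<in>{0<..}. ennreal t * ennpowr (emeasure lebesgue {x \<in> ball c r. norm (g x) > t}) (1 / q))
      \<le> ennreal (K * measure lebesgue (ball c r) powr (\<kappa> / q))" if "0 < r" for c r
    using that by (auto intro!: SUP_least)
  have "(SUP t\<in>{0<..}. ennreal t * ennpowr (emeasure lebesgue {x \<in> ball c r. norm (g x) > t}) (1 / q))
      / ennreal (measure lebesgue (ball c r) powr (\<kappa> / q)) \<le> ennreal K" if "0 < r" for c r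
    using sup[OF that, of c] measure_ball_powr(2)[OF that, of c] q
    by (subst ennreal_divide_le_iff) auto
  then show ?thesis
    unfolding weak_morrey_norm_def by (intro SUP_least) auto
qed

section \<open>Borel representatives, the sphere measure and conjugate exponents\<close>

lemma completion_ex_borel_measurable_complex:
  fixes g :: "'a \<Rightarrow> complex"
  assumes "g \<in> borel_measurable (completion M)"
  obtains g' where "g' \<in> borel_measurable M" "AE x in M. g x = g' x"
proof -
  have "(\<lambda>x. Re (g x)) \<in> borel_measurable (completion M)" "(\<lambda>x. Im (g x)) \<in> borel_measurable (completion M)"
    using assms by (simp_all add: borel_measurable_complex_iff)
  then obtain a b where ab: "a \<in> borel_measurable M" "AE x in M. Re (g x) = a x"
      "b \<in> borel_measurable M" "AE x in M. Im (g x) = b x"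
    using completion_ex_borel_measurable_real by metis
  show thesis
  proof
    show "(\<lambda>x. Complex (a x) (b x)) \<in> borel_measurable M"
      using ab by (simp add: borel_measurable_complex_iff)
    show "AE x in M. g x = Complex (a x) (b x)"
      using ab(2,4) by eventually_elim (auto simp: complex_eq_iff)
  qed
qed

text \<open>Lebesgue measure is a positive multiple of its image under the map. Reflections carry
  null sets of the kernel to null sets of the integrand; dilations spread statements from the unit
  ball to the whole space.\<close>

lemma AE_lborel_affine:
  fixes P :: "'a::euclidean_space \<Rightarrow> bool"
  assumes "AE x in lborel. P x" "c \<noteq> 0"
  shows "AE x in lborel. P (t + c *\<^sub>R x)"
proof -
  let ?D = "distr lborel borel (\<lambda>x::'a. t + c *\<^sub>R x)"
  have "AE x in density ?D (\<lambda>_. ennreal (\<bar>c\<bar> ^ DIM('a))). P x"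
    by (subst lborel_affine[OF assms(2), symmetric]) (rule assms(1))
  then have "AE x in ?D. P x"
    using assms by (simp add: AE_density)
  then show ?thesis
    by (rule AE_distrD[rotated]) simp
qed

lemma nn_integral_lborel_affine:
  fixes h :: "'a::euclidean_space \<Rightarrow> ennreal"
  assumes [measurable]: "h \<in> borel_measurable borel" and c: "c \<noteq> 0"
  shows "(\<integral>\<^sup>+x. h x \<partial>lborel) = ennreal (\<bar>c\<bar> ^ DIM('a)) * (\<integral>\<^sup>+x. h (t + c *\<^sub>R x) \<partial>lborel)"
  by (subst lborel_affine[OF c, of t]) (simp add: nn_integral_density nn_integral_distr nn_integral_cmult)

lemma AE_sphere_measure_sgn:
  fixes P :: "'a::euclidean_space \<Rightarrow> bool"
  assumes "AE z in sphere_measure. P z"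
  shows "AE x in lborel. P (sgn x)"
proof -
  let ?U = "uniform_measure lborel (ball 0 1 :: 'a set)"
  have "AE z in distr ?U borel sgn. z \<in> sphere 0 1 \<longrightarrow> P z"
    using assms unfolding sphere_measure_def by (simp add: AE_completion_iff AE_restrict_space_iff)
  then have ae: "AE x in ?U. sgn x \<in> sphere 0 1 \<longrightarrow> P (sgn x)"
    by (rule AE_distrD[rotated]) simp
  have meas: "(\<lambda>x. indicator (ball 0 1) x / emeasure lborel (ball 0 1 :: 'a set)) \<in> borel_measurable lborel"
    by (intro borel_measurable_divide_ennreal borel_measurable_indicator borel_measurable_const) simp
  have "AE x in lborel. 0 < indicator (ball 0 1) x / emeasure lborel (ball 0 1 :: 'a set)
      \<longrightarrow> (sgn x \<in> sphere 0 1 \<longrightarrow> P (sgn x))"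
    using ae unfolding uniform_measure_def AE_density[OF meas] .
  \<comment> \<open>The density of the uniform measure is positive on the ball because the ball has
    finite volume.\<close>
  then have "AE x in lborel. x \<in> ball 0 1 \<longrightarrow> (sgn x \<in> sphere 0 1 \<longrightarrow> P (sgn x))"
    using less_imp_neq[OF emeasure_lborel_ball_finite[of "0::'a" 1]]
    by (auto elim!: eventually_mono simp: divide_ennreal_def indicator_def ennreal_inverse_positive)
  then have unit: "AE x in lborel. x \<in> ball 0 1 \<longrightarrow> x \<noteq> 0 \<longrightarrow> P (sgn x)"
    by eventually_elim (auto simp: norm_sgn)
  \<comment> \<open>Countably many contractions bring every point into the unit ball without
    changing \<open>sgn x\<close>.\<close>
  have "AE x in lborel. \<forall>k::nat. 0 + inverse (real (Suc k)) *\<^sub>R x \<in> ball 0 1 \<longrightarrow> 0 + inverse (real (Suc k)) *\<^sub>R x \<noteq> 0 \<longrightarrow>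
      P (sgn (0 + inverse (real (Suc k)) *\<^sub>R x))"
    unfolding AE_all_countable by (intro allI AE_lborel_affine[OF unit]) simp
  with AE_lborel_singleton[of 0] show ?thesis
  proof eventually_elim
    case (elim x)
    obtain k :: nat where "norm x < real k"
      using reals_Archimedean2 by blast
    then have "norm (inverse (real (Suc k)) *\<^sub>R x) < 1"
      by (simp add: field_simps)
    with elim have "P (sgn (inverse (real (Suc k)) *\<^sub>R x))"
      by (auto simp del: of_nat_Suc)
    then show ?case
      by (simp add: sgn_scaleR del: of_nat_Suc)
  qed
qed

lemma nn_integral_sphere_measure:
  fixes h :: "'a::euclidean_space \<Rightarrow> ennreal"
  assumes [measurable]: "h \<in> borel_measurable borel"
  shows "(\<integral>\<^sup>+z. h z \<partial>sphere_measure) = (\<integral>\<^sup>+x\<in>ball 0 1. h (sgn x) \<partial>lborel) / emeasure lborel (ball 0 1 :: 'a set)"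
proof -
  have [measurable]: "ball a s \<in> sets borel" "sphere a s \<in> sets borel" for a :: 'a and s by simp_all
  let ?U = "uniform_measure lborel (ball 0 1 :: 'a set)"
  have "(\<integral>\<^sup>+z. h z \<partial>sphere_measure) = (\<integral>\<^sup>+z. h z * indicator (sphere 0 1) z \<partial>distr ?U borel sgn)"
    unfolding sphere_measure_def nn_integral_completion by (subst nn_integral_restrict_space) auto
  also have "\<dots> = (\<integral>\<^sup>+x. h (sgn x) * indicator (sphere 0 1) (sgn x) \<partial>?U)"
    by (subst nn_integral_distr) measurable
  also have "\<dots> = (\<integral>\<^sup>+x. h (sgn x) * indicator (sphere 0 1) (sgn x) * indicator (ball 0 1) x \<partial>lborel) / emeasure lborel (ball 0 1 :: 'a set)"
    by (subst nn_integral_uniform_measure) measurable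
  also have "(\<integral>\<^sup>+x. h (sgn x) * indicator (sphere 0 1) (sgn x) * indicator (ball 0 1) x \<partial>lborel)
      = (\<integral>\<^sup>+x\<in>ball 0 1. h (sgn x) \<partial>lborel)"
  \<comment> \<open>The two integrands can differ only at the origin, since \<open>sgn 0 = 0\<close>
    is off the sphere.\<close>
  proof (rule nn_integral_cong_AE)
    show "AE x in lborel. h (sgn x) * indicator (sphere 0 1) (sgn x) * indicator (ball 0 1) x = h (sgn x) * indicator (ball 0 1) x"
      using AE_lborel_singleton[of "0::'a"] by eventually_elim (simp add: norm_sgn indicator_def)
  qed
  finally show ?thesis .
qed

text \<open>Measurability of \<open>\<Omega>\<close> is known only for the completed sphere measure.
  A Borel version on the sphere, composed with \<open>sgn\<close>, is a Borel function on the whole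
  space that is homogeneous everywhere.\<close>

lemma homogeneous_borel_representative:
  fixes \<Omega> :: "'a::euclidean_space \<Rightarrow> complex"
  assumes meas: "\<Omega> \<in> borel_measurable sphere_measure" and hom: "homogeneous_degree_0 \<Omega>"
  obtains h where "h \<in> borel_measurable borel" "AE z in sphere_measure. \<Omega> z = h z" "AE x in lborel. \<Omega> x = h (sgn x)"
proof -
  let ?D = "distr (uniform_measure lborel (ball 0 1)) borel (sgn :: 'a \<Rightarrow> 'a)"
  obtain g where g: "g \<in> borel_measurable (restrict_space ?D (sphere 0 1))"
      "AE z in restrict_space ?D (sphere 0 1). \<Omega> z = g z"
    using meas completion_ex_borel_measurable_complex unfolding sphere_measure_def by blast
  \<comment> \<open>Extension by 0 off the sphere.\<close>
  define h where "h z = indicator (sphere 0 1) z *\<^sub>R g z" for z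
  have h: "h \<in> borel_measurable borel"
    using g(1) unfolding h_def by (subst (asm) borel_measurable_restrict_space_iff) auto
  have ae: "AE z in sphere_measure. \<Omega> z = h z"
  proof -
    have "AE z in sphere_measure. \<Omega> z = g z"
      using g(2) unfolding sphere_measure_def by (rule AE_completion)
    moreover have "AE z in sphere_measure. z \<in> sphere 0 (1::real)"
      by (rule AE_I2) (simp add: space_sphere_measure)
    ultimately show ?thesis
      by eventually_elim (simp add: h_def)
  qed
  have "AE x in lborel. \<Omega> x = h (sgn x)"
    using AE_lborel_singleton[of 0] AE_sphere_measure_sgn[OF ae]
  proof eventually_elim
    case (elim x)
    have "\<Omega> (sgn x) = \<Omega> x"
      using hom elim(1) unfolding homogeneous_degree_0_def sgn_div_norm by simp
    with elim show ?case by simp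
  qed
  with h ae show thesis by (rule that)
qed

text \<open>Hoelder's inequality with exponents \<open>\<sigma>\<close> and \<open>u\<close> on the
  ball. By homogeneity the \<open>\<sigma>\<close>-integral of the kernel there is
  \<open>r powr n\<close> times that on the unit ball, whence the exponent
  \<open>n / \<sigma> = n - n / u\<close>.\<close>

lemma homogeneous_kernel_local_bound:
  fixes W F :: "'a::euclidean_space \<Rightarrow> real"
  assumes [measurable]: "W \<in> borel_measurable borel" "F \<in> borel_measurable borel"
    and nonneg: "\<And>z. 0 \<le> W z" "\<And>y. 0 \<le> F y"
    and hom: "\<And>t z. 0 < t \<Longrightarrow> W (t *\<^sub>R z) = W z"
    and su: "1 < \<sigma>" "1 < u" "1 / \<sigma> + 1 / u = 1"
    and B: "(\<integral>\<^sup>+z\<in>ball 0 1. ennreal (W z powr \<sigma>) \<partial>lborel) \<le> ennreal B" "0 \<le> B"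
    and r: "0 < r" and v: "(\<integral>\<^sup>+y\<in>ball x r. ennreal (F y powr u) \<partial>lborel) \<le> ennreal v" "0 \<le> v"
  shows "(\<integral>\<^sup>+y\<in>ball x r. ennreal (W (x - y) * F y) \<partial>lborel)
    \<le> ennreal (B powr (1 / \<sigma>) * r powr (DIM('a) - DIM('a) / u) * v powr (1 / u))"
proof -
  have [measurable]: "ball a s \<in> sets borel" for a :: 'a and s by simp
  let ?i = "indicator (ball x r) :: 'a \<Rightarrow> real"
  have even: "W (- (r *\<^sub>R z)) = W (- z)" for z
    using hom[OF r, of "- z"] by simp
  have W: "(\<integral>\<^sup>+y. ennreal ((W (x - y) * ?i y) powr \<sigma>) \<partial>lborel) \<le> ennreal (B * r powr DIM('a))"
  proof -
    \<comment> \<open>The substitution \<open>y = x - r z\<close> turns \<open>W (x - y)\<close>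
      into \<open>W (r z) = W z\<close>.\<close>
    have "(\<integral>\<^sup>+y. ennreal ((W (x - y) * ?i y) powr \<sigma>) \<partial>lborel)
        = ennreal (\<bar>- r\<bar> ^ DIM('a)) * (\<integral>\<^sup>+z. ennreal ((W (x - (x + (- r) *\<^sub>R z)) * ?i (x + (- r) *\<^sub>R z)) powr \<sigma>) \<partial>lborel)"
      using r by (intro nn_integral_lborel_affine) auto
    also have "(\<integral>\<^sup>+z. ennreal ((W (x - (x + (- r) *\<^sub>R z)) * ?i (x + (- r) *\<^sub>R z)) powr \<sigma>) \<partial>lborel)
        = (\<integral>\<^sup>+z\<in>ball 0 1. ennreal (W z powr \<sigma>) \<partial>lborel)"
      using r su hom by (intro nn_integral_cong) (auto simp: indicator_def dist_norm)
    also have "ennreal (\<bar>- r\<bar> ^ DIM('a)) * \<dots> \<le> ennreal (\<bar>- r\<bar> ^ DIM('a)) * ennreal B"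
      by (intro mult_left_mono B) auto
    also have "\<dots> = ennreal (B * r powr DIM('a))"
      using r B by (simp add: powr_realpow mult.commute flip: ennreal_mult)
    finally show ?thesis .
  qed
  have F: "(\<integral>\<^sup>+y. ennreal ((F y * ?i y) powr u) \<partial>lborel) \<le> ennreal v"
  proof -
    have "(\<integral>\<^sup>+y. ennreal ((F y * ?i y) powr u) \<partial>lborel) = (\<integral>\<^sup>+y\<in>ball x r. ennreal (F y powr u) \<partial>lborel)"
      by (intro nn_integral_cong) (auto simp: indicator_def)
    then show ?thesis using v by simp
  qed
  have "(\<integral>\<^sup>+y\<in>ball x r. ennreal (W (x - y) * F y) \<partial>lborel) = (\<integral>\<^sup>+y. ennreal ((W (x - y) * ?i y) * (F y * ?i y)) \<partial>lborel)"
    by (intro nn_integral_cong) (auto simp: indicator_def)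
  also have "\<dots> \<le> ennreal ((B * r powr DIM('a)) powr (1 / \<sigma>) * v powr (1 / u))"
    by (intro nn_integral_Holder W F su v) (use nonneg B in auto)
  also have "(B * r powr DIM('a)) powr (1 / \<sigma>) = B powr (1 / \<sigma>) * r powr (DIM('a) * (1 / \<sigma>))"
    using B by (simp add: powr_mult powr_powr)
  also have "DIM('a) * (1 / \<sigma>) = DIM('a) - DIM('a) / u"
  proof -
    have "1 / \<sigma> = 1 - 1 / u"
      using su(3) by simp
    then show ?thesis
      by (simp only: right_diff_distrib) simp
  qed
  finally show ?thesis .
qed

lemma ennreal_conjugate_exponent:
  fixes s s' :: ennreal
  assumes "1 < s" "1 / s + 1 / s' = 1" "s' < \<infinity>"
  obtains "s = \<infinity>" "s' = ennreal 1"
  | \<sigma> u :: real where "s = ennreal \<sigma>" "s' = ennreal u" "1 < \<sigma>" "1 < u" "1 / \<sigma> + 1 / u = 1"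
proof -
  obtain u where u: "s' = ennreal u" "0 \<le> u"
    using assms(3) by (cases s') auto
  \<comment> \<open>In extended nonnegative reals \<open>1 / 0 = \<infinity>\<close>, so
    \<open>s' = 0\<close> contradicts conjugacy.\<close>
  have u0: "0 < u"
  proof (rule ccontr)
    assume "\<not> 0 < u"
    then have "s' = 0" using u by simp
    then show False using assms(2) by (simp add: ennreal_divide_zero)
  qed
  show thesis
  proof (cases s)
    case top
    then have "1 / ennreal u = 1"
      using assms(2) u by simp
    then have "1 / u = 1"
      using u0 by (simp add: divide_ennreal flip: ennreal_1)
    then show thesis using that(1) top u by simp
  next
    case (real \<sigma>)
    then have s1: "1 < \<sigma>"
      using assms(1) by (simp flip: ennreal_1 add: ennreal_less_iff)
    have "ennreal (1 / \<sigma> + 1 / u) = ennreal 1"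
      using assms(2) u0 s1 by (simp add: real u divide_ennreal flip: ennreal_1 ennreal_plus)
    then have eq: "1 / \<sigma> + 1 / u = 1"
      using u0 s1 by (subst (asm) ennreal_inj) auto
    moreover have "0 < 1 / \<sigma>" using s1 by simp
    ultimately have "1 / u < 1" by linarith
    then have "1 < u" using u0 by simp
    then show thesis using that(2) real u s1 eq by blast
  qed
qed

section \<open>The operator applied to rescaled Morrey functions\<close>

text \<open>For each fixed \<open>x\<close> the Borel versions change the integrand only on a null
  set, so the operator keeps its value at every point, not just almost everywhere. It thereby
  becomes Borel measurable as a parameter integral.\<close>

lemma rough_op_representative:
  fixes \<Omega> \<Omega>0 f f0 :: "'a::euclidean_space \<Rightarrow> complex" and \<alpha> :: real
  assumes [measurable]: "\<Omega>0 \<in> borel_measurable borel" "f0 \<in> borel_measurable borel"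
    and \<Omega>: "AE z in lborel. \<Omega> z = \<Omega>0 z" and f: "AE y in lborel. f y = f0 y"
  shows "rough_op \<Omega> \<alpha> f \<in> borel_measurable borel"
    and "ennreal (norm (rough_op \<Omega> \<alpha> f x))
      \<le> (\<integral>\<^sup>+y. ennreal (norm (\<Omega>0 (x - y)) / norm (x - y) powr (DIM('a) - \<alpha>) * norm (f0 y)) \<partial>lborel)"
    and "(\<integral>\<^sup>+y. ennreal (norm (\<Omega>0 (x - y)) / norm (x - y) powr (DIM('a) - \<alpha>) * norm (f0 y)) \<partial>lborel) < \<infinity>
      \<Longrightarrow> integrable lebesgue (rough_integrand \<Omega> \<alpha> f x)"
proof -
  have [measurable]: "(\<lambda>(x, y). rough_integrand \<Omega>0 \<alpha> f0 x y) \<in> borel_measurable (borel \<Otimes>\<^sub>M lborel)"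
    unfolding rough_integrand_def by measurable
  have [measurable]: "rough_integrand \<Omega>0 \<alpha> f0 x \<in> borel_measurable borel" for x
    unfolding rough_integrand_def by measurable
  have ae: "AE y in lebesgue. rough_integrand \<Omega>0 \<alpha> f0 x y = rough_integrand \<Omega> \<alpha> f x y" for x
  proof -
    have "AE y in lborel. \<Omega> (x + (-1) *\<^sub>R y) = \<Omega>0 (x + (-1) *\<^sub>R y)"
      by (rule AE_lborel_affine[OF \<Omega>]) simp
    with f have "AE y in lborel. rough_integrand \<Omega>0 \<alpha> f0 x y = rough_integrand \<Omega> \<alpha> f x y"
      by eventually_elim (simp add: rough_integrand_def)
    then show ?thesis by (rule AE_completion)
  qed
  have m0: "rough_integrand \<Omega>0 \<alpha> f0 x \<in> borel_measurable lebesgue" for x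
    by (rule measurable_completion) simp
  have m: "rough_integrand \<Omega> \<alpha> f x \<in> borel_measurable lebesgue" for x
    by (rule borel_measurable_AE[OF m0 ae])
  have op: "rough_op \<Omega> \<alpha> f = (\<lambda>x. LINT y|lborel. rough_integrand \<Omega>0 \<alpha> f0 x y)"
  proof
    fix x
    have "rough_op \<Omega> \<alpha> f x = (LINT y|lebesgue. rough_integrand \<Omega>0 \<alpha> f0 x y)"
      unfolding rough_op_def using ae[of x] by (intro integral_cong_AE m m0) (auto elim!: eventually_mono)
    then show "rough_op \<Omega> \<alpha> f x = (LINT y|lborel. rough_integrand \<Omega>0 \<alpha> f0 x y)"
      by (simp add: integral_completion)
  qed
  show "rough_op \<Omega> \<alpha> f \<in> borel_measurable borel"
    unfolding op by measurable
  have norm_eq: "norm (rough_integrand \<Omega>0 \<alpha> f0 x y) = norm (\<Omega>0 (x - y)) / norm (x - y) powr (DIM('a) - \<alpha>) * norm (f0 y)" for y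
    by (simp add: rough_integrand_def norm_mult norm_divide)
  show "ennreal (norm (rough_op \<Omega> \<alpha> f x))
      \<le> (\<integral>\<^sup>+y. ennreal (norm (\<Omega>0 (x - y)) / norm (x - y) powr (DIM('a) - \<alpha>) * norm (f0 y)) \<partial>lborel)"
  proof (cases "integrable lborel (rough_integrand \<Omega>0 \<alpha> f0 x)")
    case True
    then show ?thesis
      using integral_norm_bound_ennreal[OF True] by (simp add: op norm_eq)
  next
    \<comment> \<open>Without integrability the Bochner integral is 0, so the norm bound holds
      trivially.\<close>
    case False
    then show ?thesis
      by (simp add: op not_integrable_integral_eq)
  qed
  assume "(\<integral>\<^sup>+y. ennreal (norm (\<Omega>0 (x - y)) / norm (x - y) powr (DIM('a) - \<alpha>) * norm (f0 y)) \<partial>lborel) < \<infinity>"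
  then have "integrable lborel (rough_integrand \<Omega>0 \<alpha> f0 x)"
    by (simp add: integrable_iff_bounded norm_eq)
  then have "integrable lebesgue (rough_integrand \<Omega>0 \<alpha> f0 x)"
    by (simp add: integrable_completion)
  then show "integrable lebesgue (rough_integrand \<Omega> \<alpha> f x)"
    by (rule integrable_cong_AE_imp[OF _ m]) (use ae[of x] in \<open>auto elim!: eventually_mono\<close>)
qed

text \<open>The Morrey norm may be 0, so a function cannot be divided by it. Rescaling by any larger
  \<open>N\<close> and letting \<open>N\<close> decrease to the norm gives the same bound.\<close>

lemma ennreal_le_mult_of_approx:
  fixes a b :: ennreal and C :: real
  assumes a: "a < \<infinity>" and C: "0 < C"
    and le: "\<And>N. 0 < N \<Longrightarrow> a < ennreal N \<Longrightarrow> b \<le> ennreal (C * N)"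
  shows "b \<le> ennreal C * a"
proof -
  obtain r where r: "a = ennreal r" "0 \<le> r"
    using a by (cases a) auto
  have "b \<le> ennreal (C * r)"
  proof (rule ennreal_le_epsilon)
    fix e :: real assume e: "0 < e"
    then have "b \<le> ennreal (C * (r + e / C))"
      using C r by (intro le) (auto simp: ennreal_less_iff add_nonneg_pos)
    also have "C * (r + e / C) = C * r + e"
      using C by (simp add: field_simps)
    finally show "b \<le> ennreal (C * r) + ennreal e"
      using C r e by (simp add: ennreal_plus)
  qed
  then show ?thesis
    using C r by (simp add: ennreal_mult)
qed

text \<open>Reduces an arbitrary Morrey function to \<open>morrey_unit\<close>. The divisor contains
  the power \<open>\<kappa> / p\<close> of the unit ball volume because the Morrey norm uses the
  measure of a ball and \<open>morrey_unit\<close> a power of its radius.\<close>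

lemma rough_op_normalized:
  fixes \<Omega> \<Omega>0 :: "'a::euclidean_space \<Rightarrow> complex"
  assumes kernel: "rough_kernel (\<lambda>z. norm (\<Omega>0 z)) \<alpha> \<kappa> p q u A"
    and [measurable]: "\<Omega>0 \<in> borel_measurable borel" and \<Omega>: "AE z in lborel. \<Omega> z = \<Omega>0 z"
    and f: "f \<in> morrey_space p \<kappa>"
  shows "rough_op \<Omega> \<alpha> f \<in> borel_measurable borel"
    and "AE x in lebesgue. integrable lebesgue (rough_integrand \<Omega> \<alpha> f x)"
    and "0 < N \<Longrightarrow> morrey_norm p \<kappa> f < ennreal N \<Longrightarrow>
      \<exists>F. rough_kernel.morrey_unit \<kappa> p F \<and> (\<forall>x. ennreal (norm (rough_op \<Omega> \<alpha> f x) / (N * unit_ball_vol DIM('a) powr (\<kappa> / p)))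
        \<le> rough_kernel.potential (\<lambda>z. norm (\<Omega>0 z)) \<alpha> F x)"
proof -
  interpret rough_kernel "\<lambda>z. norm (\<Omega>0 z)" \<alpha> \<kappa> p q u A by fact
  have "f \<in> borel_measurable lebesgue" and fin: "morrey_norm p \<kappa> f < \<infinity>"
    using f by (simp_all add: morrey_space_def)
  then obtain f0 where f0 [measurable]: "f0 \<in> borel_measurable borel" and ae: "AE y in lborel. f y = f0 y"
    using completion_ex_borel_measurable_complex[of f lborel] by auto
  note rep = rough_op_representative[OF assms(2) f0 \<Omega> ae, where \<alpha> = \<alpha>]
  let ?I = "\<lambda>x. \<integral>\<^sup>+y. ennreal (norm (\<Omega>0 (x - y)) / norm (x - y) powr (DIM('a) - \<alpha>) * norm (f0 y)) \<partial>lborel"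
  show "rough_op \<Omega> \<alpha> f \<in> borel_measurable borel"
    by (rule rep(1))
  have unit: "morrey_unit (\<lambda>y. norm (f0 y) / (N * vol powr (\<kappa> / p)))"
    and pot: "potential (\<lambda>y. norm (f0 y) / (N * vol powr (\<kappa> / p))) x = ennreal (1 / (N * vol powr (\<kappa> / p))) * ?I x"
    if N: "0 < N" "morrey_norm p \<kappa> f < ennreal N" for N x
  proof -
    define D where "D = N * vol powr (\<kappa> / p)"
    have D: "0 < D" using N vol_pos by (simp add: D_def)
    have Dp: "D powr p = N powr p * vol powr \<kappa>"
      using N vol_pos pos by (simp add: D_def powr_mult powr_powr)
    show "morrey_unit (\<lambda>y. norm (f0 y) / (N * vol powr (\<kappa> / p)))"
      unfolding morrey_unit_def D_def[symmetric]
    proof (intro conjI allI impI)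
      fix x :: 'a and r :: real assume r: "0 < r"
      have [measurable]: "ball x r \<in> sets borel" by simp
      have "(\<integral>\<^sup>+y\<in>ball x r. ennreal ((norm (f0 y) / D) powr p) \<partial>lborel)
          = (\<integral>\<^sup>+y. ennreal (1 / D powr p) * (ennreal (norm (f y) powr p) * indicator (ball x r) y) \<partial>lborel)"
        using ae D by (intro nn_integral_cong_AE)
          (auto elim!: eventually_mono simp: powr_divide indicator_def simp flip: ennreal_mult)
      also have "\<dots> = ennreal (1 / D powr p) * (\<integral>\<^sup>+y\<in>ball x r. ennreal (norm (f y) powr p) \<partial>lborel)"
      proof -
        have "(\<integral>\<^sup>+y. ennreal (1 / D powr p) * (ennreal (norm (f y) powr p) * indicator (ball x r) y) \<partial>lborel)
          = (\<integral>\<^sup>+y. ennreal (1 / D powr p) * (ennreal (norm (f0 y) powr p) * indicator (ball x r) y) \<partial>lborel)"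
          using ae by (intro nn_integral_cong_AE) (auto elim!: eventually_mono)
        also have "\<dots> = ennreal (1 / D powr p) * (\<integral>\<^sup>+y\<in>ball x r. ennreal (norm (f0 y) powr p) \<partial>lborel)"
          by (rule nn_integral_cmult) measurable
        also have "(\<integral>\<^sup>+y\<in>ball x r. ennreal (norm (f0 y) powr p) \<partial>lborel) = (\<integral>\<^sup>+y\<in>ball x r. ennreal (norm (f y) powr p) \<partial>lborel)"
          using ae by (intro nn_integral_cong_AE) (auto elim!: eventually_mono)
        finally show ?thesis .
      qed
      also have "\<dots> \<le> ennreal (1 / D powr p) * ennreal (N powr p * (unit_ball_vol DIM('a) powr \<kappa> * r powr (DIM('a) * \<kappa>)))"
        using N pos r morrey_norm_le_iff[of p N \<kappa> f] by (intro mult_left_mono) auto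
      also have "\<dots> = ennreal (r powr (DIM('a) * \<kappa>))"
        using D N vol_pos by (simp add: Dp flip: ennreal_mult vol_def)
      finally show "(\<integral>\<^sup>+y\<in>ball x r. ennreal ((norm (f0 y) / D) powr p) \<partial>lborel) \<le> ennreal (r powr (DIM('a) * \<kappa>))" .
    qed (use D in auto)
    have "potential (\<lambda>y. norm (f0 y) / D) x = (\<integral>\<^sup>+y. ennreal (1 / D) *
        ennreal (norm (\<Omega>0 (x - y)) / norm (x - y) powr (DIM('a) - \<alpha>) * norm (f0 y)) \<partial>lborel)"
      unfolding potential_def using D by (intro nn_integral_cong) (auto simp flip: ennreal_mult)
    also have "\<dots> = ennreal (1 / D) * ?I x"
      by (rule nn_integral_cmult) measurable
    finally show "potential (\<lambda>y. norm (f0 y) / (N * vol powr (\<kappa> / p))) x = ennreal (1 / (N * vol powr (\<kappa> / p))) * ?I x"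
      by (simp only: D_def)
  qed
  show "AE x in lebesgue. integrable lebesgue (rough_integrand \<Omega> \<alpha> f x)"
  proof -
    \<comment> \<open>Any finite bound above the norm will do: a positive rescaling does not affect
      where the potential is finite.\<close>
    obtain N where N: "0 < N" "morrey_norm p \<kappa> f < ennreal N"
    proof -
      obtain r where "morrey_norm p \<kappa> f = ennreal r" "0 \<le> r"
        using fin by (cases "morrey_norm p \<kappa> f") auto
      then show thesis
        by (intro that[of "r + 1"]) (auto simp: ennreal_less_iff)
    qed
    have D: "0 < N * vol powr (\<kappa> / p)"
      using N vol_pos by simp
    have "AE x in lborel. integrable lebesgue (rough_integrand \<Omega> \<alpha> f x)"
      using potential_finite_AE[OF unit[OF N]]
    proof eventually_elim
      case (elim x)
      then have "?I x < \<infinity>"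
        using D unfolding pot[OF N] by (auto simp: ennreal_mult_less_top)
      then show ?case by (rule rep(3))
    qed
    then show ?thesis by (rule AE_completion)
  qed
  assume N: "0 < N" "morrey_norm p \<kappa> f < ennreal N"
  have D: "0 < N * vol powr (\<kappa> / p)"
    using N vol_pos by simp
  have "ennreal (norm (rough_op \<Omega> \<alpha> f x) / (N * vol powr (\<kappa> / p))) \<le> potential (\<lambda>y. norm (f0 y) / (N * vol powr (\<kappa> / p))) x" for x
  proof -
    have "ennreal (norm (rough_op \<Omega> \<alpha> f x) / (N * vol powr (\<kappa> / p)))
        = ennreal (1 / (N * vol powr (\<kappa> / p))) * ennreal (norm (rough_op \<Omega> \<alpha> f x))"
      using D by (simp flip: ennreal_mult)
    also have "\<dots> \<le> ennreal (1 / (N * vol powr (\<kappa> / p))) * ?I x"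
      by (intro mult_left_mono rep(2)) auto
    finally show ?thesis
      by (simp only: pot[OF N])
  qed
  then show "\<exists>F. morrey_unit F \<and> (\<forall>x. ennreal (norm (rough_op \<Omega> \<alpha> f x) / (N * unit_ball_vol DIM('a) powr (\<kappa> / p))) \<le> potential F x)"
    using unit[OF N] unfolding vol_def by blast
qed


text \<open>For \<open>s = \<infinity>\<close> the essential supremum gives the local bound with
  \<open>u = 1\<close>; for finite \<open>s\<close> it comes from the
  \<open>\<sigma>\<close>-integral on the sphere, transferred to the unit ball.\<close>

lemma rough_kernel_sphere:
  fixes \<Omega> :: "'a::euclidean_space \<Rightarrow> complex" and s s' :: ennreal and \<alpha> \<kappa> p q :: real
  assumes s: "1 < s" "1 / s + 1 / s' = 1" "s' \<le> ennreal p"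
    and \<Omega>: "\<Omega> \<in> Lp_space sphere_measure s" "homogeneous_degree_0 \<Omega>"
    and \<alpha>: "0 < \<alpha>" "\<alpha> < DIM('a)"
    and p: "1 \<le> p" "p < q"
    and \<kappa>: "0 < \<kappa>" "\<kappa> < 1 - \<alpha> * p / DIM('a)"
    and q: "1 / q = 1 / p - \<alpha> / (DIM('a) * (1 - \<kappa>))"
  obtains \<Omega>0 u A where "\<Omega>0 \<in> borel_measurable borel" "AE z in lborel. \<Omega> z = \<Omega>0 z"
    "s' = ennreal u" "1 \<le> u" "rough_kernel (\<lambda>z. norm (\<Omega>0 z)) \<alpha> \<kappa> p q u A"
proof -
  have meas: "\<Omega> \<in> borel_measurable sphere_measure"
    using \<Omega>(1) by (simp add: Lp_space_def)
  from meas \<Omega>(2) obtain h where h [measurable]: "h \<in> borel_measurable borel"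
    and ae: "AE z in sphere_measure. \<Omega> z = h z" "AE x in lborel. \<Omega> x = h (sgn x)"
    by (rule homogeneous_borel_representative)
  define \<Omega>0 where "\<Omega>0 x = h (sgn x)" for x
  have [measurable]: "\<Omega>0 \<in> borel_measurable borel"
    unfolding \<Omega>0_def by measurable
  have "s' < \<infinity>"
    using s(3) by (auto simp: less_top[symmetric] top_unique)
  with s(1,2) show thesis
  proof (cases rule: ennreal_conjugate_exponent)
    case 1
    obtain A0 where A0: "esssup sphere_measure (\<lambda>z. ennreal (norm (\<Omega> z))) = ennreal A0" "0 \<le> A0"
      using \<Omega>(1) 1 by (cases "esssup sphere_measure (\<lambda>z. ennreal (norm (\<Omega> z)))") (auto simp: Lp_space_def)
    \<comment> \<open>The added 1 keeps the constant positive when \<open>\<Omega>\<close> vanishes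
      almost everywhere.\<close>
    define A where "A = A0 + 1"
    have A: "0 < A"
      using A0 by (simp add: A_def)
    have "AE z in sphere_measure. norm (h z) \<le> A"
      using ae(1) esssup_AE[of "\<lambda>z. ennreal (norm (\<Omega> z))" sphere_measure] unfolding A0
      by eventually_elim (use A0 in \<open>auto simp: A_def ennreal_le_iff\<close>)
    then have bdd: "AE x in lborel. norm (\<Omega>0 x) \<le> A"
      unfolding \<Omega>0_def by (rule AE_sphere_measure_sgn)
    have "rough_kernel (\<lambda>z. norm (\<Omega>0 z)) \<alpha> \<kappa> p q 1 A"
    proof
      fix F :: "'a \<Rightarrow> real" and x r v
      assume [measurable]: "F \<in> borel_measurable borel" and F: "\<And>y. 0 \<le> F y" and r: "0 < r" and v: "0 \<le> v"
        "(\<integral>\<^sup>+y\<in>ball x r. ennreal (F y powr 1) \<partial>lborel) \<le> ennreal v"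
      have [measurable]: "ball x r \<in> sets borel" by simp
      have "AE y in lborel. norm (\<Omega>0 (x + (-1) *\<^sub>R y)) \<le> A"
        by (rule AE_lborel_affine[OF bdd]) simp
      then have "(\<integral>\<^sup>+y\<in>ball x r. ennreal (norm (\<Omega>0 (x - y)) * F y) \<partial>lborel)
          \<le> (\<integral>\<^sup>+y. ennreal A * (ennreal (F y powr 1) * indicator (ball x r) y) \<partial>lborel)"
        using F A by (intro nn_integral_mono_AE)
          (auto elim!: eventually_mono simp: indicator_def simp flip: ennreal_mult intro!: ennreal_leI mult_right_mono)
      also have "\<dots> = ennreal A * (\<integral>\<^sup>+y\<in>ball x r. ennreal (F y powr 1) \<partial>lborel)"
        by (rule nn_integral_cmult) measurable
      also have "\<dots> \<le> ennreal A * ennreal v"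
        by (intro mult_left_mono v) auto
      finally show "(\<integral>\<^sup>+y\<in>ball x r. ennreal (norm (\<Omega>0 (x - y)) * F y) \<partial>lborel)
          \<le> ennreal (A * r powr (DIM('a) - DIM('a) / 1) * v powr (1 / 1))"
        using v A r by (simp add: ennreal_mult)
    qed (use A \<alpha> p \<kappa> q in auto)
    then show thesis
      using that[of \<Omega>0 1 A] ae(2) 1 by (simp add: \<Omega>0_def[symmetric])
  next
    case (2 \<sigma> u)
    have up: "u \<le> p"
      using s(3) 2 p by (simp add: ennreal_le_iff)
    have "(\<integral>\<^sup>+z. ennreal (norm (h z) powr \<sigma>) \<partial>sphere_measure) = (\<integral>\<^sup>+z. ennreal (norm (\<Omega> z) powr \<sigma>) \<partial>sphere_measure)"
      using ae(1) by (intro nn_integral_cong_AE) (auto elim!: eventually_mono)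
    also have "\<dots> < \<infinity>"
      using \<Omega>(1) 2 by (simp add: Lp_space_def)
    finally have "(\<integral>\<^sup>+x\<in>ball 0 1. ennreal (norm (\<Omega>0 x) powr \<sigma>) \<partial>lborel) / emeasure lborel (ball 0 1 :: 'a set) < \<infinity>"
      by (subst (asm) nn_integral_sphere_measure) (auto simp: \<Omega>0_def)
    then have "(\<integral>\<^sup>+x\<in>ball 0 1. ennreal (norm (\<Omega>0 x) powr \<sigma>) \<partial>lborel) \<noteq> \<infinity>"
      using less_imp_neq[OF emeasure_lborel_ball_finite[of "0::'a" 1]] by (auto simp: ennreal_top_divide)
    then obtain B where B: "(\<integral>\<^sup>+x\<in>ball 0 1. ennreal (norm (\<Omega>0 x) powr \<sigma>) \<partial>lborel) = ennreal B" "0 \<le> B"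
      by (cases "\<integral>\<^sup>+x\<in>ball 0 1. ennreal (norm (\<Omega>0 x) powr \<sigma>) \<partial>lborel") auto
    \<comment> \<open>Here too \<open>B + 1\<close> replaces \<open>B\<close> to keep the constant
      positive.\<close>
    have "rough_kernel (\<lambda>z. norm (\<Omega>0 z)) \<alpha> \<kappa> p q u ((B + 1) powr (1 / \<sigma>))"
    proof
      fix F :: "'a \<Rightarrow> real" and x r v
      assume F: "F \<in> borel_measurable borel" "\<And>y. 0 \<le> F y" "0 < r" "0 \<le> v"
        "(\<integral>\<^sup>+y\<in>ball x r. ennreal (F y powr u) \<partial>lborel) \<le> ennreal v"
      show "(\<integral>\<^sup>+y\<in>ball x r. ennreal (norm (\<Omega>0 (x - y)) * F y) \<partial>lborel)
          \<le> ennreal ((B + 1) powr (1 / \<sigma>) * r powr (DIM('a) - DIM('a) / u) * v powr (1 / u))"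
        using B by (intro homogeneous_kernel_local_bound F 2)
          (auto simp: \<Omega>0_def sgn_scaleR intro!: ennreal_leI)
    qed (use B \<alpha> p up \<kappa> q 2 in auto)
    then show thesis
      using that[of \<Omega>0 u] ae(2) 2 by (simp add: \<Omega>0_def[symmetric])
  qed
qed

section \<open>Norm bounds with constants uniform in f\<close>

theorem rough_op_morrey_bounds:
  fixes \<Omega> :: "'a::euclidean_space \<Rightarrow> complex"
  assumes kernel: "rough_kernel (\<lambda>z. norm (\<Omega>0 z)) \<alpha> \<kappa> p q u A"
    and [measurable]: "\<Omega>0 \<in> borel_measurable borel" and \<Omega>: "AE z in lborel. \<Omega> z = \<Omega>0 z"
  shows rough_op_weak_bound: "u = p \<Longrightarrow> \<exists>C>0. \<forall>f \<in> morrey_space p \<kappa>.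
      (AE x in lebesgue. integrable lebesgue (rough_integrand \<Omega> \<alpha> f x)) \<and>
      rough_op \<Omega> \<alpha> f \<in> weak_morrey_space q \<kappa> \<and>
      weak_morrey_norm q \<kappa> (rough_op \<Omega> \<alpha> f) \<le> ennreal C * morrey_norm p \<kappa> f"
    and rough_op_strong_bound: "u < p \<Longrightarrow> \<exists>C>0. \<forall>f \<in> morrey_space p \<kappa>.
      (AE x in lebesgue. integrable lebesgue (rough_integrand \<Omega> \<alpha> f x)) \<and>
      rough_op \<Omega> \<alpha> f \<in> morrey_space q \<kappa> \<and>
      morrey_norm q \<kappa> (rough_op \<Omega> \<alpha> f) \<le> ennreal C * morrey_norm p \<kappa> f"
proof -
  interpret rough_kernel "\<lambda>z. norm (\<Omega>0 z)" \<alpha> \<kappa> p q u A by fact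
  note normalized = rough_op_normalized[OF kernel assms(2) \<Omega>]
  define c0 where "c0 = vol powr (\<kappa> / p)"
  have c0: "0 < c0" using vol_pos by (simp add: c0_def)
  \<comment> \<open>Undoes the normalization: \<open>c0\<close> from rescaling \<open>f\<close>, and
    \<open>vol powr \<kappa>\<close> from returning to the measure of the ball, under the
    \<open>q\<close>-th root of the outer norm.\<close>
  define const where "const B = (B / vol powr \<kappa>) powr (1 / q) * c0" for B
  have const_pos: "0 < const B" if "0 < B" for B
    using that vol_pos c0 by (simp add: const_def)
  have const_eq: "(const B * N) powr q * (unit_ball_vol DIM('a) powr \<kappa> * x) = (N * c0) powr q * (B * x)"
    if "0 < B" "0 < N" for B N x
  proof -
    have "(const B * N) powr q = (N * c0) powr q * (B / vol powr \<kappa>)"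
      using that vol_pos c0 pos by (simp add: const_def powr_mult powr_powr)
    then show ?thesis
      using vol_pos by (simp flip: vol_def)
  qed
  {
    assume up: "u = p"
    define B where "B = Cp powr q * vol * (1 + 5 ^ DIM('a) * 2 powr (DIM('a) * \<kappa>))"
    have B: "0 < B"
      using Cp_pos vol_pos by (auto simp: B_def intro!: mult_pos_pos add_pos_pos)
    have "(AE x in lebesgue. integrable lebesgue (rough_integrand \<Omega> \<alpha> f x)) \<and>
        rough_op \<Omega> \<alpha> f \<in> weak_morrey_space q \<kappa> \<and>
        weak_morrey_norm q \<kappa> (rough_op \<Omega> \<alpha> f) \<le> ennreal (const B) * morrey_norm p \<kappa> f"
      if f: "f \<in> morrey_space p \<kappa>" for f
    proof -
      let ?T = "rough_op \<Omega> \<alpha> f"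
      note [measurable] = normalized(1)[OF f]
      have fin: "morrey_norm p \<kappa> f < \<infinity>"
        using f by (simp add: morrey_space_def)
      have le: "weak_morrey_norm q \<kappa> ?T \<le> ennreal (const B) * morrey_norm p \<kappa> f"
        using fin const_pos[OF B]
      proof (rule ennreal_le_mult_of_approx)
        fix N :: real assume N: "0 < N" "morrey_norm p \<kappa> f < ennreal N"
        define D where "D = N * c0"
        have D: "0 < D" using N c0 by (simp add: D_def)
        obtain F where F: "morrey_unit F" "\<And>x. ennreal (norm (?T x) / D) \<le> potential F x"
          using normalized(3)[OF f N] unfolding D_def c0_def vol_def by blast
        show "weak_morrey_norm q \<kappa> ?T \<le> ennreal (const B * N)"
        proof (rule weak_morrey_norm_le)
          fix c :: 'a and r t :: real assume r: "0 < r" and t: "0 < t"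
          let ?S = "{x \<in> ball c r. t < norm (?T x)}"
          \<comment> \<open>The estimate for unit functions is taken at level \<open>t / D\<close>;
            multiplication by \<open>D powr q\<close> then restores \<open>t powr q\<close>.\<close>
          have "ennreal ((t / D) powr q) * emeasure lborel {x \<in> ball c r. t / D < norm (?T x) / D}
              \<le> ennreal (B * r powr (DIM('a) * \<kappa>))"
            unfolding B_def using r t D by (intro weak_estimate[OF F(1)] F(2) up) auto
          also have "{x \<in> ball c r. t / D < norm (?T x) / D} = ?S"
            using D by (auto simp: divide_less_cancel)
          finally have "ennreal (D powr q) * (ennreal ((t / D) powr q) * emeasure lborel ?S)
              \<le> ennreal (D powr q) * ennreal (B * r powr (DIM('a) * \<kappa>))"
            by (intro mult_left_mono) auto
          moreover have "ennreal (D powr q) * (ennreal ((t / D) powr q) * emeasure lborel ?S) = ennreal (t powr q) * emeasure lborel ?S"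
            using D t by (simp add: powr_divide flip: mult.assoc ennreal_mult)
          ultimately show "ennreal (t powr q) * emeasure lborel ?S
              \<le> ennreal ((const B * N) powr q * (unit_ball_vol DIM('a) powr \<kappa> * r powr (DIM('a) * \<kappa>)))"
            unfolding const_eq[OF B N(1)] using B by (simp add: ennreal_mult D_def)
        qed (use pos const_pos[OF B] N in auto)
      qed
      moreover have "ennreal (const B) * morrey_norm p \<kappa> f < \<infinity>"
        using fin by (simp add: ennreal_mult_less_top)
      ultimately have "?T \<in> weak_morrey_space q \<kappa>"
        using normalized(1)[OF f] by (simp add: weak_morrey_space_def measurable_completion le_less_trans)
      with le normalized(2)[OF f] show ?thesis by blast
    qed
    with const_pos[OF B] show "\<exists>C>0. \<forall>f \<in> morrey_space p \<kappa>.
      (AE x in lebesgue. integrable lebesgue (rough_integrand \<Omega> \<alpha> f x)) \<and>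
      rough_op \<Omega> \<alpha> f \<in> weak_morrey_space q \<kappa> \<and>
      weak_morrey_norm q \<kappa> (rough_op \<Omega> \<alpha> f) \<le> ennreal C * morrey_norm p \<kappa> f"
      by blast
  }
  {
    assume up: "u < p"
    have B: "0 < Cs"
      using up by (rule Cs_pos)
    have "(AE x in lebesgue. integrable lebesgue (rough_integrand \<Omega> \<alpha> f x)) \<and>
        rough_op \<Omega> \<alpha> f \<in> morrey_space q \<kappa> \<and>
        morrey_norm q \<kappa> (rough_op \<Omega> \<alpha> f) \<le> ennreal (const Cs) * morrey_norm p \<kappa> f"
      if f: "f \<in> morrey_space p \<kappa>" for f
    proof -
      let ?T = "rough_op \<Omega> \<alpha> f"
      note [measurable] = normalized(1)[OF f]
      have fin: "morrey_norm p \<kappa> f < \<infinity>"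
        using f by (simp add: morrey_space_def)
      have le: "morrey_norm q \<kappa> ?T \<le> ennreal (const Cs) * morrey_norm p \<kappa> f"
        using fin const_pos[OF B]
      proof (rule ennreal_le_mult_of_approx)
        fix N :: real assume N: "0 < N" "morrey_norm p \<kappa> f < ennreal N"
        define D where "D = N * c0"
        have D: "0 < D" using N c0 by (simp add: D_def)
        obtain F where F: "morrey_unit F" "\<And>x. ennreal (norm (?T x) / D) \<le> potential F x"
          using normalized(3)[OF f N] unfolding D_def c0_def vol_def by blast
        have "(\<integral>\<^sup>+x\<in>ball c r. ennreal (norm (?T x) powr q) \<partial>lborel)
            \<le> ennreal ((const Cs * N) powr q * (unit_ball_vol DIM('a) powr \<kappa> * r powr (DIM('a) * \<kappa>)))"
          if r: "0 < r" for c :: 'a and r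
        proof -
          have [measurable]: "ball c r \<in> sets borel" by simp
          have "(\<integral>\<^sup>+x\<in>ball c r. ennreal (norm (?T x) powr q) \<partial>lborel)
              = (\<integral>\<^sup>+x. ennreal (D powr q) * (ennreal ((norm (?T x) / D) powr q) * indicator (ball c r) x) \<partial>lborel)"
            using D by (intro nn_integral_cong) (auto simp: powr_divide indicator_def simp flip: ennreal_mult)
          also have "\<dots> = ennreal (D powr q) * (\<integral>\<^sup>+x\<in>ball c r. ennreal ((norm (?T x) / D) powr q) \<partial>lborel)"
            by (rule nn_integral_cmult) measurable
          also have "\<dots> \<le> ennreal (D powr q) * ennreal (Cs * r powr (DIM('a) * \<kappa>))"
            using r D by (intro mult_left_mono strong_estimate[OF F(1)] F(2) up) auto
          also have "\<dots> = ennreal ((const Cs * N) powr q * (unit_ball_vol DIM('a) powr \<kappa> * r powr (DIM('a) * \<kappa>)))"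
            unfolding const_eq[OF B N(1)] using B by (simp add: D_def flip: ennreal_mult)
          finally show ?thesis .
        qed
        then show "morrey_norm q \<kappa> ?T \<le> ennreal (const Cs * N)"
          using pos const_pos[OF B] N by (subst morrey_norm_le_iff) auto
      qed
      moreover have "ennreal (const Cs) * morrey_norm p \<kappa> f < \<infinity>"
        using fin by (simp add: ennreal_mult_less_top)
      ultimately have "?T \<in> morrey_space q \<kappa>"
        using normalized(1)[OF f] by (simp add: morrey_space_def measurable_completion le_less_trans)
      with le normalized(2)[OF f] show ?thesis by blast
    qed
    with const_pos[OF B] show "\<exists>C>0. \<forall>f \<in> morrey_space p \<kappa>.
      (AE x in lebesgue. integrable lebesgue (rough_integrand \<Omega> \<alpha> f x)) \<and>
      rough_op \<Omega> \<alpha> f \<in> morrey_space q \<kappa> \<and>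
      morrey_norm q \<kappa> (rough_op \<Omega> \<alpha> f) \<le> ennreal C * morrey_norm p \<kappa> f"
      by blast
  }
qed

theorem theorem2p10:
  fixes \<Omega> :: "real ^ 'n \<Rightarrow> complex"
    and s s' :: ennreal
    and \<alpha> p q \<kappa> :: real
  assumes n: "CARD('n) \<ge> 2"
    and s: "1 < s" "1 / s + 1 / s' = 1"
    and \<Omega>: "\<Omega> \<in> Lp_space sphere_measure s" "homogeneous_degree_0 \<Omega>"
    and \<alpha>: "0 < \<alpha>" "\<alpha> < real CARD('n)"
    and p: "1 \<le> p" "p < q"
    and \<kappa>: "0 < \<kappa>" "\<kappa> < 1 - \<alpha> * p / real CARD('n)"
    and q: "1 / q = 1 / p - \<alpha> / (real CARD('n) * (1 - \<kappa>))"
  shows "(s' = ennreal p \<and> p < real CARD('n) / \<alpha> \<longrightarrow>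
           (\<exists>C>0. \<forall>f \<in> morrey_space p \<kappa>.
              (AE x in lebesgue. integrable lebesgue (rough_integrand \<Omega> \<alpha> f x)) \<and>
              rough_op \<Omega> \<alpha> f \<in> weak_morrey_space q \<kappa> \<and>
              weak_morrey_norm q \<kappa> (rough_op \<Omega> \<alpha> f) \<le> ennreal C * morrey_norm p \<kappa> f)) \<and>
         (s' < ennreal p \<and> p < real CARD('n) / \<alpha> \<longrightarrow>
           (\<exists>C>0. \<forall>f \<in> morrey_space p \<kappa>.
              (AE x in lebesgue. integrable lebesgue (rough_integrand \<Omega> \<alpha> f x)) \<and>
              rough_op \<Omega> \<alpha> f \<in> morrey_space q \<kappa> \<and>
              morrey_norm q \<kappa> (rough_op \<Omega> \<alpha> f) \<le> ennreal C * morrey_norm p \<kappa> f))"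
proof -
  have dim: "real DIM(real ^ 'n) = real CARD('n)"
    by simp
  \<comment> \<open>An elimination rule with arbitrary \<open>thesis\<close>, so that both parts can
    draw the kernel data from it for their own goals.\<close>
  have kernel: thesis
    if "s' \<le> ennreal p" and "\<And>\<Omega>0 u A. \<Omega>0 \<in> borel_measurable borel \<Longrightarrow> AE z in lborel. \<Omega> z = \<Omega>0 z \<Longrightarrow>
      s' = ennreal u \<Longrightarrow> 1 \<le> u \<Longrightarrow> rough_kernel (\<lambda>z. norm (\<Omega>0 z)) \<alpha> \<kappa> p q u A \<Longrightarrow> thesis" for thesis
    by (rule rough_kernel_sphere[OF s that(1) \<Omega>, of \<alpha> q \<kappa>]) (use \<alpha> p \<kappa> q that(2) in \<open>simp_all only: dim\<close>)
  show ?thesis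
  proof (intro conjI impI)
    assume A: "s' = ennreal p \<and> p < real CARD('n) / \<alpha>"
    show "\<exists>C>0. \<forall>f \<in> morrey_space p \<kappa>.
        (AE x in lebesgue. integrable lebesgue (rough_integrand \<Omega> \<alpha> f x)) \<and>
        rough_op \<Omega> \<alpha> f \<in> weak_morrey_space q \<kappa> \<and>
        weak_morrey_norm q \<kappa> (rough_op \<Omega> \<alpha> f) \<le> ennreal C * morrey_norm p \<kappa> f"
    proof (rule kernel)
      fix \<Omega>0 :: "real ^ 'n \<Rightarrow> complex" and u B
      assume *: "\<Omega>0 \<in> borel_measurable borel" "AE z in lborel. \<Omega> z = \<Omega>0 z"
        "s' = ennreal u" "1 \<le> u" "rough_kernel (\<lambda>z. norm (\<Omega>0 z)) \<alpha> \<kappa> p q u B"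
      then have "u = p"
        using A p by auto
      then show ?thesis
        by (rule rough_op_weak_bound[OF *(5,1,2)])
    qed (use A in simp)
  next
    assume A: "s' < ennreal p \<and> p < real CARD('n) / \<alpha>"
    show "\<exists>C>0. \<forall>f \<in> morrey_space p \<kappa>.
        (AE x in lebesgue. integrable lebesgue (rough_integrand \<Omega> \<alpha> f x)) \<and>
        rough_op \<Omega> \<alpha> f \<in> morrey_space q \<kappa> \<and>
        morrey_norm q \<kappa> (rough_op \<Omega> \<alpha> f) \<le> ennreal C * morrey_norm p \<kappa> f"
    proof (rule kernel)
      fix \<Omega>0 :: "real ^ 'n \<Rightarrow> complex" and u B
      assume *: "\<Omega>0 \<in> borel_measurable borel" "AE z in lborel. \<Omega> z = \<Omega>0 z"
        "s' = ennreal u" "1 \<le> u" "rough_kernel (\<lambda>z. norm (\<Omega>0 z)) \<alpha> \<kappa> p q u B"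
      then have "u < p"
        using A by (simp add: ennreal_less_iff)
      then show ?thesis
        by (rule rough_op_strong_bound[OF *(5,1,2)])
    qed (use A in \<open>simp add: less_imp_le\<close>)
  qed
qed

end
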